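(* Let $\gamma\in(1/2,1)$ and let $x=\{x(t),t\ge0\}$ be a zero mean Gaussian process with $x(0)=0$, with $\mathrm{Var}(x(t))>0$ for every $t>0$, and such that for every $T>0$ there is a constant $C_T$ with $$\mathbb{E}(|x(t)-x(s)|^2)\le C_T|t-s|^{2\gamma}\quad\text{for all } s,t\in[0,T].$$ Let $\{x_{ij},1\le i\le j\le d\}$ be independent copies of $x$ (with continuous trajectories). Let $X(0)$ be a fixed deterministic real symmetric $d\times d$ matrix, and let $X(t)=X(0)+\widehat X(t)$, where $\widehat X(t)$ is the symmetric $d\times d$ matrix with entries $\widehat X_{ij}(t)=x_{ij}(t)$ if $i<j$ and $\widehat X_{ii}(t)=\sqrt2\,x_{ii}(t)$. Let $\lambda_1(t)\ge\cdots\ge\lambda_d(t)$ denote the eigenvalues of $X(t)$. Then $$P\big(\lambda_1(t)>\cdots>\lambda_d(t),\ \forall t>0\big)=1.$$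
   Context: By Kolmogorov's continuity theorem, a process satisfying the stated increment bound has a version whose trajectories are Hölder continuous of order $\beta$ on bounded intervals for every $\beta<\gamma$; such versions are used for the $x_{ij}$. No other non-standard notions are needed. *)

theory Defs
  imports
    "HOL-Probability.Probability"
    "HOL-Computational_Algebra.Fundamental_Theorem_Algebra"
    "Jordan_Normal_Form.Char_Poly"
begin

(* Degenerate (constant) Gaussian laws are included, as is needed for x(0) = 0. *)
definition gaussian_rv :: "'a measure \<Rightarrow> ('a \<Rightarrow> real) \<Rightarrow> bool" where
  "gaussian_rv M Y \<longleftrightarrow> Y \<in> borel_measurable M \<and>
     (\<exists>\<mu>. distr M borel Y = return borel \<mu> \<or>
        (\<exists>\<sigma>>0. distributed M lborel Y (normal_density \<mu> \<sigma>)))"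

(* All finite-dimensional distributions are (possibly degenerate) multivariate normal:
   every finite linear combination of the variables is a real Gaussian variable. *)
definition gaussian_process :: "'a measure \<Rightarrow> 't set \<Rightarrow> ('t \<Rightarrow> 'a \<Rightarrow> real) \<Rightarrow> bool" where
  "gaussian_process M T Y \<longleftrightarrow>
     (\<forall>t\<in>T. Y t \<in> borel_measurable M) \<and>
     (\<forall>J c. finite J \<longrightarrow> J \<subseteq> T \<longrightarrow> gaussian_rv M (\<lambda>\<omega>. \<Sum>t\<in>J. c t * Y t \<omega>))"

abbreviation path_space :: "(real \<Rightarrow> real) measure" where
  "path_space \<equiv> PiM {0..} (\<lambda>_. borel)"

(* A process with time set [0,\<infinity>), viewed as a single random element of the path space. *)
definition path :: "(real \<Rightarrow> 'a \<Rightarrow> real) \<Rightarrow> 'a \<Rightarrow> real \<Rightarrow> real" where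
  "path Y \<omega> = (\<lambda>t\<in>{0..}. Y t \<omega>)"

(* The law on the product sigma-algebra is determined by the finite-dimensional
   distributions, so equality of laws is equality of all finite-dimensional distributions. *)
definition independent_copies ::
  "'a measure \<Rightarrow> 'i set \<Rightarrow> ('i \<Rightarrow> real \<Rightarrow> 'a \<Rightarrow> real) \<Rightarrow> 'b measure \<Rightarrow> (real \<Rightarrow> 'b \<Rightarrow> real) \<Rightarrow> bool" where
  "independent_copies M I Y N x \<longleftrightarrow>
     prob_space.indep_vars M (\<lambda>_. path_space) (\<lambda>i. path (Y i)) I \<and>
     (\<forall>i\<in>I. distr M path_space (path (Y i)) = distr N path_space (path x))"

(* Indices run over 0, ..., d - 1; only the entries Y (i, j) with i \<le> j are used. *)
definition sym_noise :: "nat \<Rightarrow> (nat \<times> nat \<Rightarrow> real \<Rightarrow> 'a \<Rightarrow> real) \<Rightarrow> real \<Rightarrow> 'a \<Rightarrow> real mat" where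
  "sym_noise d Y t \<omega> = mat d d (\<lambda>(i, j).
     if i = j then sqrt 2 * Y (i, i) t \<omega>
     else if i < j then Y (i, j) t \<omega>
     else Y (j, i) t \<omega>)"

(* The k-th largest real eigenvalue, counted from k = 0 with algebraic multiplicity.
   For a real symmetric d x d matrix all roots of the characteristic polynomial are real,
   so this is meaningful for every k < d. *)
definition eigval :: "real mat \<Rightarrow> nat \<Rightarrow> real" where
  "eigval A k = rev (sorted_list_of_multiset (proots (char_poly A))) ! k"

end

theory Submission
  imports Defs
begin

text \<open>
  A symmetric matrix with a repeated eigenvalue is the image, under one of finitely many polynomial
  maps, of a parameter vector with two coordinates fewer than the number \<open>D\<close> of entries on and above
  the diagonal. Hence the bounded degenerate matrices are covered by \<open>O(r\<^bsup>2-D\<^esup>)\<close> balls of radius \<open>r\<close>.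
  For \<open>t\<close> in a compact subinterval of \<open>(0,\<infinity>)\<close> the entries of \<open>X(t)\<close> are independent with uniformly
  bounded densities, so \<open>X(t)\<close> lies within \<open>O(r)\<close> of this set with probability \<open>O(r\<^sup>2)\<close>. Gaussian
  moments and dyadic chaining show that, off events of small probability, \<open>X\<close> moves by at most
  \<open>O(2\<^bsup>-m\<beta>\<^esup>)\<close> on every dyadic interval of length \<open>2\<^bsup>-m\<^esup>\<close>, for some \<open>\<beta> > 1/2\<close>. Taking \<open>r = 2\<^bsup>-m\<beta>\<^esup>\<close>, the
  probability of meeting the degenerate set is at most of order \<open>2\<^sup>m \<cdot> 2\<^bsup>-2m\<beta>\<^esup>\<close>, which tends to \<open>0\<close>.
\<close>

subsection \<open>Repeated eigenvalues of symmetric matrices\<close>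

text \<open>The margin is exact: a gain of r^2 from codimension two is paid against r^(-1/\<beta>)
  time intervals, and this tends to 0 precisely when \<beta> > 1/2. The second moment bound alone
  cannot supply such a \<beta>: Chebyshev on dyadic intervals would require 2(\<gamma> - \<beta>) >
  1, impossible for \<gamma> < 1 and \<beta> > 1/2. Gaussianity turns the bound into moments of
  every order, and then every \<beta> < \<gamma> is within reach. The discriminant is a single
  equation and does not display codimension two; charts built from a pair of independent
  eigenvectors do. These charts have unbounded parameters, and X(0) may itself be degenerate while
  the densities of the entries blow up as t tends to 0. Hence both the parameters and the time axis
  are exhausted by countably many compact pieces, each contributing a null event.\<close>

lemma order_linear_mult_ge_2:
  fixes p q :: "real poly"
  assumes "p = [:-m, 1:] * q" "q \<noteq> 0"
  shows "2 \<le> order m p \<longleftrightarrow> poly q m = 0"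
proof -
  have p0: "[:-m, 1:] * q \<noteq> 0"
    using assms(2) by (metis mult_eq_0_iff pCons_eq_0_iff one_neq_zero)
  have "order m p = 1 + order m q"
    unfolding assms(1) order_mult[OF p0] using order_power_n_n[of m 1] by simp
  then show ?thesis using assms(2) order_root[of q m] by auto
qed

text \<open>The reflection I - (2/|w|^2) w w^T in the hyperplane orthogonal to w = a - e_0 swaps the
  unit vectors a and e_0. It makes no sense for w = 0, whence the case split. Being symmetric and
  its own inverse, it serves below as an orthogonal change of basis without any inverse to carry
  along.\<close>

lemma householder:
  fixes a :: "real vec"
  assumes a: "a \<in> carrier_vec n" and aa: "scalar_prod a a = 1" and n: "0 < n"
  shows "\<exists>H. H \<in> carrier_mat n n \<and> H * H = 1\<^sub>m n \<and> transpose_mat H = H \<and> H *\<^sub>v a = unit_vec n 0"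
proof (cases "a = unit_vec n 0")
  case True
  then show ?thesis by (intro exI[of _ "1\<^sub>m n"]) auto
next
  case False
  define w where "w i = a $ i - (if i = 0 then 1 else 0)" for i
  define s where "s = (\<Sum>k<n. w k * w k)"
  define c where "c = 2 / s"
  define H where "H = mat n n (\<lambda>(i,j). (if i = j then 1 else 0) - c * (w i * w j))"
  have aa': "(\<Sum>k<n. a $ k * a $ k) = 1"
    using aa a by (simp add: scalar_prod_def lessThan_atLeast0)
  have s_eq: "s = 2 * (1 - a $ 0)"
  proof -
    have "s = (\<Sum>k<n. a $ k * a $ k + (if k = 0 then 1 - 2 * a $ 0 else 0))"
      unfolding s_def w_def by (intro sum.cong) (auto simp: algebra_simps)
    also have "\<dots> = 1 + (1 - 2 * a $ 0)"
      using aa' n by (simp add: sum.distrib)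
    finally show ?thesis by simp
  qed
  have wa: "(\<Sum>k<n. w k * a $ k) = 1 - a $ 0"
  proof -
    have "(\<Sum>k<n. w k * a $ k) = (\<Sum>k<n. a $ k * a $ k - (if k = 0 then a $ 0 else 0))"
      unfolding w_def by (intro sum.cong) (auto simp: algebra_simps)
    then show ?thesis using aa' n by (simp add: sum_subtractf)
  qed
  have s0: "s \<noteq> 0"
  proof
    assume "s = 0"
    then have "\<forall>k<n. w k * w k = 0"
      unfolding s_def by (subst (asm) sum_nonneg_eq_0_iff) auto
    then have "a = unit_vec n 0"
      using a n by (intro eq_vecI) (auto simp: w_def unit_vec_def)
    with False show False by simp
  qed
  have cs: "c * s = 2" using s0 unfolding c_def by simp
  have "c * (1 - a $ 0) = s / s" unfolding c_def by (subst (2) s_eq) simp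
  then have cwa: "c * (1 - a $ 0) = 1" using s0 by simp
  have H: "H \<in> carrier_mat n n" unfolding H_def by simp
  have HH: "H * H = 1\<^sub>m n"
  proof (rule eq_matI)
    fix i j assume ij: "i < dim_row (1\<^sub>m n)" "j < dim_col (1\<^sub>m n)"
    let ?d = "\<lambda>i j. if i = j then 1 else (0::real)"
    have "(H * H) $$ (i,j) = (\<Sum>k<n. (?d i k - c * (w i * w k)) * (?d k j - c * (w k * w j)))"
      using ij by (simp add: H_def scalar_prod_def lessThan_atLeast0)
    also have "\<dots> = (\<Sum>k<n. (if k = i then ?d i j else 0) - (if k = i then c * (w i * w j) else 0)
        - (if k = j then c * (w i * w j) else 0) + (c * (w i * w j)) * c * (w k * w k))"
      by (intro sum.cong) (auto simp: algebra_simps)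
    also have "\<dots> = ?d i j - 2 * c * (w i * w j) + (c * (w i * w j)) * (c * s)"
      using ij by (simp add: sum.distrib sum_subtractf s_def sum_distrib_left mult.assoc)
    also have "\<dots> = ?d i j" unfolding cs by simp
    finally show "(H * H) $$ (i,j) = 1\<^sub>m n $$ (i,j)" using ij by simp
  qed (use H in auto)
  have "transpose_mat H = H"
    by (rule eq_matI) (auto simp: H_def mult.commute)
  moreover have "H *\<^sub>v a = unit_vec n 0"
  proof (rule eq_vecI)
    fix i assume "i < dim_vec (unit_vec n 0 :: real vec)"
    then have i: "i < n" by simp
    have "(H *\<^sub>v a) $ i = (\<Sum>k<n. ((if i = k then 1 else 0) - c * (w i * w k)) * a $ k)"
      using i a by (simp add: H_def scalar_prod_def lessThan_atLeast0)
    also have "\<dots> = (\<Sum>k<n. (if k = i then a $ i else 0) - (c * w i) * (w k * a $ k))"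
      by (intro sum.cong) (auto simp: algebra_simps)
    also have "\<dots> = a $ i - w i * (c * (1 - a $ 0))"
      using i by (simp add: sum_subtractf wa flip: sum_distrib_left)
    also have "\<dots> = unit_vec n 0 $ i" using i unfolding cwa by (simp add: w_def unit_vec_def)
    finally show "(H *\<^sub>v a) $ i = unit_vec n 0 $ i" .
  qed (use H in auto)
  ultimately show ?thesis using H HH by blast
qed

text \<open>Conjugation by the reflection that sends a to e_0 makes the first column of A equal to
  \<mu> e_0, and by symmetry the first row too. The remaining block \<open>A'\<close> then carries
  the characteristic polynomial divided by X - \<mu>, so \<mu> is at least double iff it is an
  eigenvalue of \<open>A'\<close>. Vectors with vanishing coordinate 0 correspond under the
  reflection to vectors orthogonal to a.\<close>

lemma symmetric_deflation:
  fixes A :: "real mat"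
  assumes A: "A \<in> carrier_mat n n" and sym: "transpose_mat A = A"
    and a: "a \<in> carrier_vec n" and aa: "scalar_prod a a = 1" and ev: "A *\<^sub>v a = \<mu> \<cdot>\<^sub>v a"
  shows "2 \<le> order \<mu> (char_poly A) \<longleftrightarrow>
    (\<exists>b \<in> carrier_vec n. b \<noteq> 0\<^sub>v n \<and> scalar_prod a b = 0 \<and> A *\<^sub>v b = \<mu> \<cdot>\<^sub>v b)"
proof -
  have n: "0 < n" using a aa by (cases n) (auto simp: scalar_prod_def)
  then obtain m where m: "n = Suc m" by (cases n) auto
  obtain H where H: "H \<in> carrier_mat n n" and HH: "H * H = 1\<^sub>m n" and HT: "transpose_mat H = H"
    and Ha: "H *\<^sub>v a = unit_vec n 0"
    using householder[OF a aa n] by blast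
  define e where "e = (unit_vec n 0 :: real vec)"
  have e: "e \<in> carrier_vec n" unfolding e_def by simp
  have HHv: "H *\<^sub>v (H *\<^sub>v v) = v" if "v \<in> carrier_vec n" for v
    using assoc_mult_mat_vec[OF H H that] that HH by simp
  have He: "H *\<^sub>v e = a" using HHv[OF a] Ha unfolding e_def by simp
  define B where "B = H * A * H"
  have B: "B \<in> carrier_mat n n" using H A unfolding B_def by simp
  have Bv: "B *\<^sub>v v = H *\<^sub>v (A *\<^sub>v (H *\<^sub>v v))" if "v \<in> carrier_vec n" for v
    using that H A assoc_mult_mat_vec[of "H * A" n n H n v] assoc_mult_mat_vec[of H n n A n "H *\<^sub>v v"]
    unfolding B_def by simp
  have Be: "B *\<^sub>v e = \<mu> \<cdot>\<^sub>v e"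
    using Bv[OF e] He ev Ha a H unfolding e_def by (simp add: mult_mat_vec[of _ n n])
  have BT: "transpose_mat B = B"
    using H A HT sym transpose_mult[of "H * A" n n H n] transpose_mult[of H n n A n]
    unfolding B_def by simp
  have B0: "B $$ (i, 0) = (if i = 0 then \<mu> else 0)" if "i < n" for i
  proof -
    have "(B *\<^sub>v e) $ i = B $$ (i,0)"
      using that B n unfolding e_def by (simp add: scalar_prod_right_unit)
    then show ?thesis using Be that n unfolding e_def by (auto simp: unit_vec_def)
  qed
  have B0': "B $$ (0, i) = (if i = 0 then \<mu> else 0)" if "i < n" for i
    using B0[OF that] index_transpose_mat(1)[of 0 B i] B BT that n by simp
  define A' where "A' = mat m m (\<lambda>(i,j). B $$ (Suc i, Suc j))"
  have A': "A' \<in> carrier_mat m m" unfolding A'_def by simp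
  have B_block: "B = four_block_mat (mat 1 1 (\<lambda>_. \<mu>)) (0\<^sub>m 1 m) (0\<^sub>m m 1) A'"
    by (rule eq_matI) (use B B0 B0' m in \<open>auto simp: A'_def\<close>)
  have "similar_mat B A"
    unfolding similar_mat_def
    by (intro exI[of _ H], intro exI[of _ H] similar_mat_witI[of _ _ n]) (use H A B HH in \<open>auto simp: B_def\<close>)
  then have cpA: "char_poly A = char_poly B" by (simp add: char_poly_similar)
  have cp1: "char_poly (mat 1 1 (\<lambda>_. \<mu>)) = [:-\<mu>, 1:]"
    by (simp add: char_poly_defs det_def sign_def)
  have "char_poly B = char_poly (mat 1 1 (\<lambda>_. \<mu>)) * char_poly A'"
    unfolding B_block by (rule char_poly_four_block_zeros_col) (use A' in auto)
  then have cp: "char_poly A = [:-\<mu>, 1:] * char_poly A'" unfolding cp1 cpA .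
  have "char_poly A' \<noteq> 0" using degree_monic_char_poly[OF A'] by auto
  then have "2 \<le> order \<mu> (char_poly A) \<longleftrightarrow> eigenvalue A' \<mu>"
    using order_linear_mult_ge_2[OF cp] eigenvalue_root_char_poly[OF A'] by simp
  also have "\<dots> \<longleftrightarrow> (\<exists>b \<in> carrier_vec n. b \<noteq> 0\<^sub>v n \<and> scalar_prod a b = 0 \<and> A *\<^sub>v b = \<mu> \<cdot>\<^sub>v b)"
  proof
    assume "eigenvalue A' \<mu>"
    then obtain w where w: "w \<in> carrier_vec m" "w \<noteq> 0\<^sub>v m" "A' *\<^sub>v w = \<mu> \<cdot>\<^sub>v w"
      unfolding eigenvalue_def eigenvector_def using A' by auto
    define v where "v = vec n (\<lambda>i. if i = 0 then 0 else w $ (i - 1))"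
    have v: "v \<in> carrier_vec n" unfolding v_def by simp
    have Bvv: "B *\<^sub>v v = \<mu> \<cdot>\<^sub>v v"
    proof (rule eq_vecI)
      fix i assume "i < dim_vec (\<mu> \<cdot>\<^sub>v v)"
      then have i: "i < Suc m" using m v by simp
      have "(B *\<^sub>v v) $ i = (\<Sum>k<Suc m. B $$ (i,k) * v $ k)"
        using i B v m by (simp add: scalar_prod_def lessThan_atLeast0)
      also have "\<dots> = (\<Sum>k<m. B $$ (i, Suc k) * w $ k)"
        unfolding sum.lessThan_Suc_shift by (simp add: v_def m)
      also have "\<dots> = \<mu> * v $ i"
      proof (cases i)
        case 0
        then show ?thesis using B0' m by (simp add: v_def)
      next
        case (Suc l)
        have "(A' *\<^sub>v w) $ l = (\<Sum>k<m. B $$ (i, Suc k) * w $ k)"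
          using i w(1) Suc m by (simp add: A'_def scalar_prod_def lessThan_atLeast0)
        then show ?thesis using w i Suc m by (simp add: v_def)
      qed
      finally show "(B *\<^sub>v v) $ i = (\<mu> \<cdot>\<^sub>v v) $ i" using i v m by simp
    qed (use B v in auto)
    have b: "H *\<^sub>v v \<in> carrier_vec n" using H v by simp
    have "scalar_prod a (H *\<^sub>v v) = scalar_prod (transpose_mat H *\<^sub>v a) v"
      using transpose_vec_mult_scalar[OF H v a] by simp
    also have "\<dots> = 0" using v n unfolding HT Ha by (simp add: v_def)
    finally have orth: "scalar_prod a (H *\<^sub>v v) = 0" .
    have "H *\<^sub>v v \<noteq> 0\<^sub>v n"
    proof
      assume "H *\<^sub>v v = 0\<^sub>v n"
      then have v0: "v = 0\<^sub>v n" using HHv[OF v] H by auto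
      have "w = 0\<^sub>v m"
      proof (rule eq_vecI)
        fix i assume "i < dim_vec (0\<^sub>v m :: real vec)"
        then show "w $ i = 0\<^sub>v m $ i" using arg_cong[OF v0, of "\<lambda>x. x $ Suc i"] m by (simp add: v_def)
      qed (use w in auto)
      with w show False by simp
    qed
    moreover have "A *\<^sub>v (H *\<^sub>v v) = \<mu> \<cdot>\<^sub>v (H *\<^sub>v v)"
    proof -
      have "A *\<^sub>v (H *\<^sub>v v) = H *\<^sub>v (B *\<^sub>v v)"
        using Bv[OF v] HHv[of "A *\<^sub>v (H *\<^sub>v v)"] A H v by auto
      then show ?thesis unfolding Bvv using H v by (simp add: mult_mat_vec)
    qed
    ultimately show "\<exists>b \<in> carrier_vec n. b \<noteq> 0\<^sub>v n \<and> scalar_prod a b = 0 \<and> A *\<^sub>v b = \<mu> \<cdot>\<^sub>v b"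
      using b orth by blast
  next
    assume "\<exists>b \<in> carrier_vec n. b \<noteq> 0\<^sub>v n \<and> scalar_prod a b = 0 \<and> A *\<^sub>v b = \<mu> \<cdot>\<^sub>v b"
    then obtain b where b: "b \<in> carrier_vec n" "b \<noteq> 0\<^sub>v n" "scalar_prod a b = 0" "A *\<^sub>v b = \<mu> \<cdot>\<^sub>v b" by blast
    define v where "v = H *\<^sub>v b"
    have v: "v \<in> carrier_vec n" using H b unfolding v_def by simp
    have Bvv: "B *\<^sub>v v = \<mu> \<cdot>\<^sub>v v"
      using Bv[OF v] HHv[OF b(1)] b H unfolding v_def by (simp add: mult_mat_vec[of _ n n])
    have "v $ 0 = scalar_prod (unit_vec n 0) v" using v n by simp
    also have "\<dots> = scalar_prod (transpose_mat H *\<^sub>v a) v" unfolding HT Ha ..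
    also have "\<dots> = scalar_prod a (H *\<^sub>v v)" using transpose_vec_mult_scalar[OF H v a] by simp
    also have "\<dots> = 0" unfolding v_def HHv[OF b(1)] by (fact b)
    finally have v0: "v $ 0 = 0" .
    define w where "w = vec m (\<lambda>i. v $ Suc i)"
    have w: "w \<in> carrier_vec m" unfolding w_def by simp
    have "A' *\<^sub>v w = \<mu> \<cdot>\<^sub>v w"
    proof (rule eq_vecI)
      fix l assume "l < dim_vec (\<mu> \<cdot>\<^sub>v w)"
      then have l: "l < m" using w by simp
      have "(A' *\<^sub>v w) $ l = (\<Sum>k<m. B $$ (Suc l, Suc k) * v $ Suc k)"
        using l w by (simp add: A'_def scalar_prod_def lessThan_atLeast0 w_def)
      also have "\<dots> = (\<Sum>k<Suc m. B $$ (Suc l, k) * v $ k)"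
        unfolding sum.lessThan_Suc_shift by (simp add: v0)
      also have "\<dots> = (B *\<^sub>v v) $ Suc l"
        using l B v m by (simp add: scalar_prod_def lessThan_atLeast0)
      finally show "(A' *\<^sub>v w) $ l = (\<mu> \<cdot>\<^sub>v w) $ l"
        unfolding Bvv using l v m by (simp add: w_def)
    qed (use A' w in auto)
    moreover have "w \<noteq> 0\<^sub>v m"
    proof
      assume w0: "w = 0\<^sub>v m"
      have "v = 0\<^sub>v n"
      proof (rule eq_vecI)
        fix i assume "i < dim_vec (0\<^sub>v n :: real vec)"
        then show "v $ i = 0\<^sub>v n $ i"
          using arg_cong[OF w0, of "\<lambda>x. x $ (i - 1)"] m v0 by (cases i) (auto simp: w_def)
      qed (use v in auto)
      then have "b = 0\<^sub>v n" using HHv[OF b(1)] H unfolding v_def by auto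
      with b show False by simp
    qed
    ultimately show "eigenvalue A' \<mu>"
      unfolding eigenvalue_def eigenvector_def using w A' by auto
  qed
  finally show ?thesis .
qed

section \<open>Real spectrum of symmetric matrices and the sorted list of eigenvalues\<close>

lemma eigenvalue_of_real_symmetric_real:
  fixes A :: "real mat"
  assumes A: "A \<in> carrier_mat n n" and sym: "transpose_mat A = A"
    and ev: "eigenvalue (map_mat complex_of_real A) z"
  shows "z \<in> \<real>"
proof -
  have Aij: "A $$ (i,j) = A $$ (j,i)" if "i < n" "j < n" for i j
    using index_transpose_mat(1)[of i A j] A sym that by simp
  obtain v where v: "v \<in> carrier_vec n" "v \<noteq> 0\<^sub>v n" "map_mat complex_of_real A *\<^sub>v v = z \<cdot>\<^sub>v v"
    using ev A unfolding eigenvalue_def eigenvector_def by auto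
  have row: "(\<Sum>j<n. complex_of_real (A $$ (i,j)) * v $ j) = z * v $ i" if i: "i < n" for i
  proof -
    have "(map_mat complex_of_real A *\<^sub>v v) $ i = (\<Sum>j<n. complex_of_real (A $$ (i,j)) * v $ j)"
      using i A v(1) by (simp add: scalar_prod_def lessThan_atLeast0)
    then show ?thesis using v i by simp
  qed
  \<comment> \<open>The Hermitian form v* A v: it equals z |v|^2 because v is an eigenvector, and it
    is its own conjugate because A is real and symmetric.\<close>
  define S where "S = (\<Sum>i<n. \<Sum>j<n. cnj (v $ i) * complex_of_real (A $$ (i,j)) * v $ j)"
  define T where "T = (\<Sum>i<n. (cmod (v $ i))\<^sup>2)"
  have S1: "S = z * complex_of_real T"
  proof -
    have "S = (\<Sum>i<n. cnj (v $ i) * (z * v $ i))"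
      unfolding S_def using row by (intro sum.cong) (auto simp: mult.assoc simp flip: sum_distrib_left)
    also have "\<dots> = (\<Sum>i<n. z * complex_of_real ((cmod (v $ i))\<^sup>2))"
      by (intro sum.cong refl) (simp add: complex_norm_square[symmetric, unfolded of_real_power] mult.commute)
    finally show ?thesis unfolding T_def by (simp add: sum_distrib_left)
  qed
  have "cnj S = (\<Sum>i<n. \<Sum>j<n. cnj (v $ j) * complex_of_real (A $$ (i,j)) * v $ i)"
    unfolding S_def by (simp add: ac_simps)
  also have "\<dots> = (\<Sum>j<n. \<Sum>i<n. cnj (v $ j) * complex_of_real (A $$ (i,j)) * v $ i)"
    by (rule sum.swap)
  also have "\<dots> = S" unfolding S_def using Aij by (intro sum.cong) auto
  finally have "S \<in> \<real>" by (simp add: Reals_cnj_iff)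
  moreover have "T \<noteq> 0"
  proof
    assume "T = 0"
    then have "\<forall>i<n. (cmod (v $ i))\<^sup>2 = 0"
      unfolding T_def by (subst (asm) sum_nonneg_eq_0_iff) auto
    then have "v = 0\<^sub>v n" using v by (intro eq_vecI) auto
    with v show False by simp
  qed
  ultimately have "z = S / complex_of_real T" using S1 by simp
  then show ?thesis using \<open>S \<in> \<real>\<close> by simp
qed

text \<open>Over the complex numbers the polynomial splits, and its roots are real, so the
  factorization descends: the embedding of the reals is injective on coefficients.\<close>

lemma char_poly_symmetric_splits:
  fixes A :: "real mat"
  assumes A: "A \<in> carrier_mat n n" and sym: "transpose_mat A = A"
  shows "\<exists>es. length es = n \<and> char_poly A = (\<Prod>e\<leftarrow>es. [:-e, 1:])"
proof -
  let ?A = "map_mat complex_of_real A"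
  have A': "?A \<in> carrier_mat n n" using A by simp
  interpret m: map_poly_comm_ring_hom complex_of_real ..
  obtain as where as: "char_poly ?A = (\<Prod>a\<leftarrow>as. [:-a, 1:])" "length as = n"
    using char_poly_factorized[OF A'] by blast
  have real: "a \<in> \<real>" if "a \<in> set as" for a
  proof -
    have "poly (char_poly ?A) a = 0" unfolding as(1) poly_prod_list using that
      by (auto simp: prod_list_zero_iff)
    then show ?thesis
      using eigenvalue_of_real_symmetric_real[OF A sym] eigenvalue_root_char_poly[OF A'] by blast
  qed
  have "map_poly complex_of_real (char_poly A) = char_poly ?A"
    by (rule of_real_hom.char_poly_hom[OF A, symmetric])
  also have "\<dots> = (\<Prod>a\<leftarrow>as. map_poly complex_of_real [:- Re a, 1:])"
    unfolding as(1) using real by (intro arg_cong[of _ _ prod_list] map_cong) (auto elim!: Reals_cases)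
  also have "\<dots> = map_poly complex_of_real (\<Prod>a\<leftarrow>as. [:- Re a, 1:])"
    by (induction as) (auto simp: m.hom_mult simp del: mult_pCons_left)
  finally have "char_poly A = (\<Prod>a\<leftarrow>as. [:- Re a, 1:])"
  proof (intro poly_eqI)
    fix k
    assume "map_poly complex_of_real (char_poly A) = map_poly complex_of_real (\<Prod>a\<leftarrow>as. [:- Re a, 1:])"
    from arg_cong[OF this, of "\<lambda>p. coeff p k"]
    show "coeff (char_poly A) k = coeff (\<Prod>a\<leftarrow>as. [:- Re a, 1:]) k"
      by (simp add: coeff_map_poly)
  qed
  then show ?thesis using as(2) by (intro exI[of _ "map Re as"]) (simp add: o_def)
qed

text \<open>This makes the list inside \<open>eigval\<close> exactly n long, so that
  \<open>!\<close> is applied within range for every index below n.\<close>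

lemma size_proots_symmetric:
  fixes A :: "real mat"
  assumes A: "A \<in> carrier_mat n n" and sym: "transpose_mat A = A"
  shows "size (proots (char_poly A)) = n"
proof -
  obtain es where es: "length es = n" "char_poly A = (\<Prod>e\<leftarrow>es. [:-e, 1:])"
    using char_poly_symmetric_splits[OF A sym] by blast
  have "size (proots (\<Prod>e\<leftarrow>es. [:-e, 1::real:])) = length es"
  proof (induction es)
    case (Cons e es)
    have "(\<Prod>e\<leftarrow>es. [:-e, 1::real:]) \<noteq> 0" by (auto simp: prod_list_zero_iff)
    then show ?case using Cons proots_linear_factor[of "-e"] by (simp add: proots_mult del: mult_pCons_left)
  qed simp
  then show ?thesis using es by simp
qed

text \<open>A sorted list is strictly increasing iff it has no repetition, and the number of
  occurrences of \<mu> in it is its order as a root. The ordering of the eigenvalues is thereby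
  traded for a condition on multiplicities.\<close>

lemma eigval_strict_iff:
  fixes A :: "real mat"
  assumes A: "A \<in> carrier_mat n n" and sym: "transpose_mat A = A"
  shows "(\<forall>i j. i < j \<and> j < n \<longrightarrow> eigval A i > eigval A j) \<longleftrightarrow>
    (\<forall>\<mu>. \<not> 2 \<le> order \<mu> (char_poly A))"
proof -
  define xs where "xs = sorted_list_of_multiset (proots (char_poly A))"
  have mset: "mset xs = proots (char_poly A)" unfolding xs_def by simp
  then have len: "length xs = n" using size_proots_symmetric[OF A sym] by (metis size_mset)
  have sorted: "sorted xs" unfolding xs_def by simp
  have "char_poly A \<noteq> 0" using degree_monic_char_poly[OF A] by auto
  then have count: "count (mset xs) \<mu> = order \<mu> (char_poly A)" for \<mu> unfolding mset by simp
  have nth: "eigval A i = xs ! (n - Suc i)" if "i < n" for i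
    unfolding eigval_def xs_def[symmetric] using that len by (simp add: rev_nth)
  have "(\<forall>i j. i < j \<and> j < n \<longrightarrow> eigval A i > eigval A j) \<longleftrightarrow> distinct xs"
  proof
    assume L: "\<forall>i j. i < j \<and> j < n \<longrightarrow> eigval A i > eigval A j"
    have "xs ! i < xs ! j" if "i < j" "j < n" for i j
    proof -
      have "eigval A (n - Suc j) > eigval A (n - Suc i) \<longrightarrow> xs ! i < xs ! j"
        using that by (simp add: nth Suc_diff_Suc)
      then show ?thesis using L that by (simp add: diff_less_mono2)
    qed
    then show "distinct xs" unfolding distinct_conv_nth len
      by (metis less_irrefl linorder_neqE_nat)
  next
    assume "distinct xs"
    then have "xs ! i < xs ! j" if "i < j" "j < n" for i j
      using that len sorted sorted_nth_mono[OF sorted, of i j]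
      by (simp add: order_less_le nth_eq_iff_index_eq)
    then show "\<forall>i j. i < j \<and> j < n \<longrightarrow> eigval A i > eigval A j"
      by (auto simp: nth)
  qed
  also have "\<dots> \<longleftrightarrow> (\<forall>\<mu>. \<not> 2 \<le> count (mset xs) \<mu>)"
  proof
    assume "distinct xs"
    then show "\<forall>\<mu>. \<not> 2 \<le> count (mset xs) \<mu>" by (simp add: distinct_count_atmost_1)
  next
    assume "\<forall>\<mu>. \<not> 2 \<le> count (mset xs) \<mu>"
    then have "count (mset xs) \<mu> \<le> 1" for \<mu> by (metis not_less_eq_eq numeral_2_eq_2 One_nat_def)
    then have "count (mset xs) \<mu> = (if \<mu> \<in> set xs then 1 else 0)" for \<mu>
      by (metis One_nat_def antisym count_eq_zero_iff le_0_eq not_less_eq_eq set_mset_mset)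
    then show "distinct xs" unfolding distinct_count_atmost_1 by blast
  qed
  finally show ?thesis unfolding count .
qed

text \<open>Two independent eigenvectors have a nonzero 2 x 2 minor in some rows p < q, and a change
  of basis of their span turns this minor into the identity. Conversely, the normalized pair is
  independent, and Gram-Schmidt produces the orthogonal pair needed by
  \<open>symmetric_deflation\<close>. The normalization is what fixes the parameters of the charts
  used later.\<close>

lemma double_eigenvalue_iff:
  fixes A :: "real mat"
  assumes A: "A \<in> carrier_mat n n" and sym: "transpose_mat A = A"
  shows "2 \<le> order \<mu> (char_poly A) \<longleftrightarrow>
    (\<exists>p q. \<exists>u \<in> carrier_vec n. \<exists>v \<in> carrier_vec n. p < q \<and> q < n \<and> u $ p = 1 \<and> u $ q = 0 \<and> v $ p = 0 \<and> v $ q = 1 \<and>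
      A *\<^sub>v u = \<mu> \<cdot>\<^sub>v u \<and> A *\<^sub>v v = \<mu> \<cdot>\<^sub>v v)" (is "?L \<longleftrightarrow> ?R")
proof
  have unit: "\<exists>c. c \<noteq> 0 \<and> scalar_prod (c \<cdot>\<^sub>v w) (c \<cdot>\<^sub>v w) = 1"
    if w: "w \<in> carrier_vec n" "w \<noteq> 0\<^sub>v n" for w :: "real vec"
  proof -
    define s where "s = scalar_prod w w"
    have s: "s = (\<Sum>i<n. w $ i * w $ i)" using w by (simp add: s_def scalar_prod_def lessThan_atLeast0)
    have "s \<noteq> 0"
    proof
      assume "s = 0"
      then have "\<forall>i<n. w $ i * w $ i = 0" unfolding s by (subst (asm) sum_nonneg_eq_0_iff) auto
      then have "w = 0\<^sub>v n" using w by (intro eq_vecI) auto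
      with w show False by simp
    qed
    moreover have "0 \<le> s" unfolding s by (intro sum_nonneg) simp
    ultimately have "0 < s" by simp
    then show ?thesis using w
      by (intro exI[of _ "1 / sqrt s"]) (simp add: s_def[symmetric] flip: power2_eq_square)
  qed
  {
    assume L: ?L
    have "char_poly A \<noteq> 0" using degree_monic_char_poly[OF A] by auto
    then have "poly (char_poly A) \<mu> = 0" using L order_root[of "char_poly A" \<mu>] by auto
    then have "eigenvalue A \<mu>" using eigenvalue_root_char_poly[OF A] by simp
    then obtain w where w: "w \<in> carrier_vec n" "w \<noteq> 0\<^sub>v n" "A *\<^sub>v w = \<mu> \<cdot>\<^sub>v w"
      unfolding eigenvalue_def eigenvector_def using A by auto
    obtain c where c: "c \<noteq> 0" "scalar_prod (c \<cdot>\<^sub>v w) (c \<cdot>\<^sub>v w) = 1" using unit[OF w(1,2)] by blast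
    define a where "a = c \<cdot>\<^sub>v w"
    have a: "a \<in> carrier_vec n" "scalar_prod a a = 1" using w c unfolding a_def by auto
    have Aa: "A *\<^sub>v a = \<mu> \<cdot>\<^sub>v a" unfolding a_def using A w
      by (simp add: mult_mat_vec[of _ n n] smult_smult_assoc mult.commute)
    obtain b where b: "b \<in> carrier_vec n" "b \<noteq> 0\<^sub>v n" "scalar_prod a b = 0" "A *\<^sub>v b = \<mu> \<cdot>\<^sub>v b"
      using symmetric_deflation[OF A sym a Aa] L by blast
    \<comment> \<open>If all minors vanished, multiplying by a_p and summing over p would give b_q =
      a_q <a, b> = 0 for every q, since <a, a> = 1.\<close>
    have "\<exists>p q. p < n \<and> q < n \<and> a $ p * b $ q \<noteq> a $ q * b $ p"
    proof (rule ccontr)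
      assume "\<not> ?thesis"
      then have eq: "a $ p * b $ q = a $ q * b $ p" if "p < n" "q < n" for p q using that by blast
      have "b $ q = 0" if q: "q < n" for q
      proof -
        have "b $ q = (\<Sum>p<n. a $ p * a $ p) * b $ q"
          using a by (simp add: scalar_prod_def lessThan_atLeast0)
        also have "\<dots> = (\<Sum>p<n. a $ p * (a $ p * b $ q))" by (simp add: sum_distrib_right mult.assoc)
        also have "\<dots> = (\<Sum>p<n. a $ p * (a $ q * b $ p))" using eq q by (intro sum.cong) auto
        also have "\<dots> = a $ q * (\<Sum>p<n. a $ p * b $ p)" by (simp add: sum_distrib_left ac_simps)
        also have "(\<Sum>p<n. a $ p * b $ p) = 0" using b a by (simp add: scalar_prod_def lessThan_atLeast0)
        finally show ?thesis by simp
      qed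
      then have "b = 0\<^sub>v n" using b by (intro eq_vecI) auto
      with b show False by simp
    qed
    then obtain p q where pq: "p < q" "q < n" "a $ p * b $ q \<noteq> a $ q * b $ p"
      by (metis linorder_neqE_nat)
    define D where "D = a $ p * b $ q - a $ q * b $ p"
    have D: "D \<noteq> 0" using pq unfolding D_def by simp
    have lin: "A *\<^sub>v (\<alpha> \<cdot>\<^sub>v a + \<beta> \<cdot>\<^sub>v b) = \<mu> \<cdot>\<^sub>v (\<alpha> \<cdot>\<^sub>v a + \<beta> \<cdot>\<^sub>v b)" for \<alpha> \<beta>
      using A a b Aa
      by (simp add: mult_add_distrib_mat_vec[of _ n n] mult_mat_vec[of _ n n] smult_add_distrib_vec[of _ n]
          smult_smult_assoc mult.commute)
    \<comment> \<open>Coefficients from Cramer's rule: the inverse of the minor with determinant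
      \<open>D\<close>.\<close>
    define u where "u = (b $ q / D) \<cdot>\<^sub>v a + (- a $ q / D) \<cdot>\<^sub>v b"
    define v where "v = (- b $ p / D) \<cdot>\<^sub>v a + (a $ p / D) \<cdot>\<^sub>v b"
    have "u \<in> carrier_vec n" "v \<in> carrier_vec n" using a b unfolding u_def v_def by auto
    moreover have "u $ p = 1" "u $ q = 0" "v $ p = 0" "v $ q = 1"
      using a b pq D unfolding u_def v_def
      by (auto simp: D_def divide_simps mult.commute)
    moreover have "A *\<^sub>v u = \<mu> \<cdot>\<^sub>v u" "A *\<^sub>v v = \<mu> \<cdot>\<^sub>v v" unfolding u_def v_def by (fact lin)+
    ultimately show ?R using pq by blast
  }
  assume ?R
  then obtain p q and u v :: "real vec" where pq: "p < q" "q < n" and u: "u \<in> carrier_vec n" and v: "v \<in> carrier_vec n"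
    and uv: "u $ p = 1" "u $ q = 0" "v $ p = 0" "v $ q = 1"
    and Au: "A *\<^sub>v u = \<mu> \<cdot>\<^sub>v u" and Av: "A *\<^sub>v v = \<mu> \<cdot>\<^sub>v v" by blast
  have "u \<noteq> 0\<^sub>v n" using uv pq by auto
  then obtain c where c: "c \<noteq> 0" "scalar_prod (c \<cdot>\<^sub>v u) (c \<cdot>\<^sub>v u) = 1" using unit[OF u] by blast
  define a where "a = c \<cdot>\<^sub>v u"
  have a: "a \<in> carrier_vec n" "scalar_prod a a = 1" using u c unfolding a_def by auto
  have Aa: "A *\<^sub>v a = \<mu> \<cdot>\<^sub>v a" unfolding a_def using A u Au
    by (simp add: mult_mat_vec[of _ n n] smult_smult_assoc mult.commute)
  \<comment> \<open>Gram-Schmidt: b is v minus its projection onto the unit vector a. As a is a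
    multiple of u and u_q = 0, coordinate q of b is still 1, so b does not vanish.\<close>
  define s where "s = - scalar_prod a v"
  define b where "b = v + s \<cdot>\<^sub>v a"
  have b: "b \<in> carrier_vec n" using a v unfolding b_def by simp
  have "b $ q = 1" using pq uv u v unfolding b_def a_def by simp
  then have "b \<noteq> 0\<^sub>v n" using pq by auto
  moreover have "scalar_prod a b = 0"
    unfolding b_def using a v by (simp add: scalar_prod_add_distrib[of _ n] s_def)
  moreover have "A *\<^sub>v b = \<mu> \<cdot>\<^sub>v b" unfolding b_def using A a v Aa Av
    by (simp add: mult_add_distrib_mat_vec[of _ n n] mult_mat_vec[of _ n n] smult_add_distrib_vec[of _ n]
        smult_smult_assoc mult.commute)
  ultimately show ?L using symmetric_deflation[OF A sym a Aa] b by blast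
qed

text \<open>
  If \<open>B = A - \<mu>I\<close> kills \<open>u\<close> and \<open>v\<close> whose coordinates at \<open>(p, q)\<close> are \<open>(1, 0)\<close> and \<open>(0, 1)\<close>, then the rows
  and columns \<open>p, q\<close> of \<open>B\<close> are determined by the remaining entries of \<open>B\<close>, \<open>u\<close> and \<open>v\<close>. These
  parameters are stored in one function \<open>\<theta>\<close> on unordered pairs: \<open>\<theta>(p, p) = \<mu>\<close>, \<open>\<theta>{k, p} = u\<^sub>k\<close>,
  \<open>\<theta>{k, q} = v\<^sub>k\<close> and \<open>\<theta>{k, l} = B\<^sub>k\<^sub>l\<close> for \<open>k, l \<notin> {p, q}\<close>. The pairs \<open>(q, q)\<close> and \<open>(p, q)\<close> stay
  unused, which is why the degenerate matrices have codimension two.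
\<close>

definition upair :: "nat \<Rightarrow> nat \<Rightarrow> nat \<times> nat" where
  "upair i j = (min i j, max i j)"

definition degen_coord :: "nat \<Rightarrow> nat \<Rightarrow> (nat \<times> nat \<Rightarrow> real) \<Rightarrow> nat \<Rightarrow> nat \<Rightarrow> real" where
  "degen_coord p q \<theta> k i = (if i \<in> {p, q} then - \<theta> (upair k i) else of_bool (k = i))"

text \<open>In matrix form this is \<mu> I + Q^T C Q, where C is the block of B outside rows and
  columns p, q and Q has entries \<open>degen_coord\<close>. The kernel of Q is the span of the two
  prescribed eigenvectors.\<close>

definition degen_entry :: "nat \<Rightarrow> nat \<Rightarrow> nat \<Rightarrow> (nat \<times> nat \<Rightarrow> real) \<Rightarrow> nat \<Rightarrow> nat \<Rightarrow> real" where
  "degen_entry n p q \<theta> i j = of_bool (i = j) * \<theta> (p, p) +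
     (\<Sum>k\<in>{..<n} - {p, q}. \<Sum>l\<in>{..<n} - {p, q}.
        degen_coord p q \<theta> k i * degen_coord p q \<theta> l j * \<theta> (upair k l))"

lemma upair_commute: "upair i j = upair j i"
  by (simp add: upair_def min.commute max.commute)

lemma degen_entry_commute: "degen_entry n p q \<theta> i j = degen_entry n p q \<theta> j i"
  unfolding degen_entry_def
  by (subst sum.swap) (auto simp: upair_commute ac_simps intro!: sum.cong)

lemma sum_split_two:
  fixes f :: "nat \<Rightarrow> real"
  assumes "p < q" "q < n"
  shows "(\<Sum>k<n. f k) = f p + f q + (\<Sum>k\<in>{..<n} - {p, q}. f k)"
proof -
  have "(\<Sum>k<n. f k) = sum f {p, q} + sum f ({..<n} - {p, q})"
    using assms by (subst sum.subset_diff[of "{p,q}"]) auto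
  then show ?thesis using assms by simp
qed

text \<open>If B = A - \<mu> I is symmetric and kills u and v, its columns p and q are combinations
  of the other columns with coefficients -u and -v; doing the same for rows gives B = Q^T C Q.
  Conversely Q^T C Q kills the kernel of Q, which contains two vectors of the normalized form, so
  \<mu> is at least a double eigenvalue.\<close>

lemma simple_spectrum_iff:
  fixes A :: "real mat"
  assumes A: "A \<in> carrier_mat n n" and sym: "transpose_mat A = A"
  shows "(\<forall>i j. i < j \<and> j < n \<longrightarrow> eigval A i > eigval A j) \<longleftrightarrow>
    \<not> (\<exists>p q \<theta>. p < q \<and> q < n \<and> (\<forall>i j. i \<le> j \<and> j < n \<longrightarrow> A $$ (i, j) = degen_entry n p q \<theta> i j))"
proof -
  have Asym: "A $$ (i,j) = A $$ (j,i)" if "i < n" "j < n" for i j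
    using index_transpose_mat(1)[of i A j] A sym that by simp
  have eig: "A *\<^sub>v u = \<mu> \<cdot>\<^sub>v u \<longleftrightarrow> (\<forall>i<n. (\<Sum>j<n. (A $$ (i,j) - of_bool (i = j) * \<mu>) * u $ j) = 0)"
    if u: "u \<in> carrier_vec n" for u \<mu>
  proof -
    have "A *\<^sub>v u = \<mu> \<cdot>\<^sub>v u \<longleftrightarrow> (\<forall>i<n. (A *\<^sub>v u) $ i = \<mu> * u $ i)"
      using A u by (auto simp: vec_eq_iff)
    also have "\<dots> \<longleftrightarrow> (\<forall>i<n. (\<Sum>j<n. (A $$ (i,j) - of_bool (i = j) * \<mu>) * u $ j) = 0)"
    proof (intro all_cong1 imp_cong refl)
      fix i assume i: "i < n"
      have "(\<Sum>j<n. (A $$ (i,j) - of_bool (i = j) * \<mu>) * u $ j) =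
          (\<Sum>j<n. A $$ (i,j) * u $ j - (if j = i then \<mu> * u $ i else 0))"
        by (intro sum.cong) (auto simp: algebra_simps)
      also have "\<dots> = (A *\<^sub>v u) $ i - \<mu> * u $ i"
        using i A u by (simp add: sum_subtractf scalar_prod_def lessThan_atLeast0)
      finally show "((A *\<^sub>v u) $ i = \<mu> * u $ i) \<longleftrightarrow>
          ((\<Sum>j<n. (A $$ (i,j) - of_bool (i = j) * \<mu>) * u $ j) = 0)" by simp
    qed
    finally show ?thesis .
  qed
  have "(\<exists>\<mu>. 2 \<le> order \<mu> (char_poly A)) \<longleftrightarrow>
     (\<exists>p q \<theta>. p < q \<and> q < n \<and> (\<forall>i j. i \<le> j \<and> j < n \<longrightarrow> A $$ (i, j) = degen_entry n p q \<theta> i j))"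
  proof
    assume "\<exists>\<mu>. 2 \<le> order \<mu> (char_poly A)"
    then obtain \<mu> p q and u v :: "real vec" where pq: "p < q" "q < n" and u: "u \<in> carrier_vec n" and v: "v \<in> carrier_vec n"
      and uv: "u $ p = 1" "u $ q = 0" "v $ p = 0" "v $ q = 1"
      and Au: "A *\<^sub>v u = \<mu> \<cdot>\<^sub>v u" and Av: "A *\<^sub>v v = \<mu> \<cdot>\<^sub>v v"
      using double_eigenvalue_iff[OF A sym] by blast
    define B where "B i j = A $$ (i,j) - of_bool (i = j) * \<mu>" for i j
    have Bsym: "B i j = B j i" if "i < n" "j < n" for i j
      using Asym[OF that] unfolding B_def by (simp add: eq_commute)
    define R where "R = {..<n} - {p, q}"
    have Rn: "k < n" "k \<noteq> p" "k \<noteq> q" if "k \<in> R" for k using that unfolding R_def by auto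
    have Bu: "(\<Sum>j\<in>R. B i j * u $ j) = - B i p" if "i < n" for i
      using Au[unfolded eig[OF u]] that uv pq unfolding B_def[symmetric] R_def
      by (auto simp: sum_split_two)
    have Bv: "(\<Sum>j\<in>R. B i j * v $ j) = - B i q" if "i < n" for i
      using Av[unfolded eig[OF v]] that uv pq unfolding B_def[symmetric] R_def
      by (auto simp: sum_split_two)
    \<comment> \<open>The test for (p, p) comes first because the place that would hold the constant
      u_p = 1 stores \<mu>. Both orders of a pair are covered, since \<open>upair\<close> may put p
      or q on either side of the other index.\<close>
    define \<theta> where "\<theta> = (\<lambda>(i,j). if i = p \<and> j = p then \<mu> else if i = p then u $ j else if j = p then u $ i
      else if i = q then v $ j else if j = q then v $ i else B i j)"
    have \<theta>p: "\<theta> (upair k p) = u $ k" and \<theta>q: "\<theta> (upair k q) = v $ k" if "k \<in> R" for k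
      using Rn[OF that] pq unfolding \<theta>_def upair_def by (auto simp: min_def max_def)
    have \<theta>R: "\<theta> (upair k l) = B k l" if "k \<in> R" "l \<in> R" for k l
      using Rn[OF that(1)] Rn[OF that(2)] pq Bsym[of k l] unfolding \<theta>_def upair_def
      by (auto simp: min_def max_def)
    \<comment> \<open>Row i of B is recovered from its entries outside columns p and q: row i of Bu
      = 0, with u_p = 1 and u_q = 0, expresses the entry in column p, and v does the same for column
      q.\<close>
    have fold: "(\<Sum>l\<in>R. degen_coord p q \<theta> l j * B i l) = B i j" if ij: "i < n" "j < n" for i j
    proof (cases "j \<in> R")
      case True
      have "(\<Sum>l\<in>R. degen_coord p q \<theta> l j * B i l) = (\<Sum>l\<in>R. if l = j then B i j else 0)"
        using Rn[OF True] unfolding degen_coord_def by (intro sum.cong) auto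
      then show ?thesis using True by (simp add: R_def)
    next
      case False
      then consider "j = p" | "j = q" using ij unfolding R_def by auto
      then show ?thesis
      proof cases
        case 1
        have "(\<Sum>l\<in>R. degen_coord p q \<theta> l j * B i l) = - (\<Sum>l\<in>R. B i l * u $ l)"
          unfolding sum_negf[symmetric] using \<theta>p 1 by (intro sum.cong) (auto simp: degen_coord_def)
        then show ?thesis using Bu[OF ij(1)] 1 by simp
      next
        case 2
        have "(\<Sum>l\<in>R. degen_coord p q \<theta> l j * B i l) = - (\<Sum>l\<in>R. B i l * v $ l)"
          unfolding sum_negf[symmetric] using \<theta>q 2 by (intro sum.cong) (auto simp: degen_coord_def)
        then show ?thesis using Bv[OF ij(1)] 2 by simp
      qed
    qed
    have "A $$ (i, j) = degen_entry n p q \<theta> i j" if ij: "i < n" "j < n" for i j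
    proof -
      \<comment> \<open>\<open>fold\<close> is applied twice, once in each index, with symmetry of B
        in between.\<close>
      have "B i j = (\<Sum>k\<in>R. degen_coord p q \<theta> k i * B j k)"
        using fold[OF ij(2,1)] Bsym[OF ij] by simp
      also have "\<dots> = (\<Sum>k\<in>R. degen_coord p q \<theta> k i * (\<Sum>l\<in>R. degen_coord p q \<theta> l j * B k l))"
        using fold ij Rn Bsym by (intro sum.cong refl) (metis (no_types, lifting))
      also have "\<dots> = (\<Sum>k\<in>R. \<Sum>l\<in>R. degen_coord p q \<theta> k i * degen_coord p q \<theta> l j * \<theta> (upair k l))"
        unfolding sum_distrib_left using \<theta>R by (intro sum.cong refl) (auto simp: mult.assoc)
      finally show ?thesis
        unfolding degen_entry_def R_def B_def by (simp add: \<theta>_def)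
    qed
    then show "\<exists>p q \<theta>. p < q \<and> q < n \<and> (\<forall>i j. i \<le> j \<and> j < n \<longrightarrow> A $$ (i, j) = degen_entry n p q \<theta> i j)"
      using pq by (intro exI[of _ p] exI[of _ q] exI[of _ \<theta>]) auto
  next
    assume "\<exists>p q \<theta>. p < q \<and> q < n \<and> (\<forall>i j. i \<le> j \<and> j < n \<longrightarrow> A $$ (i, j) = degen_entry n p q \<theta> i j)"
    then obtain p q \<theta> where pq: "p < q" "q < n"
      and \<theta>: "\<And>i j. i \<le> j \<Longrightarrow> j < n \<Longrightarrow> A $$ (i, j) = degen_entry n p q \<theta> i j" by blast
    have AF: "A $$ (i, j) = degen_entry n p q \<theta> i j" if "i < n" "j < n" for i j
      using \<theta>[of i j] \<theta>[of j i] Asym[OF that] degen_entry_commute[of n p q \<theta> i j] that by (cases "i \<le> j") auto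
    define R where "R = {..<n} - {p, q}"
    \<comment> \<open>Every w with Qw = 0 is an eigenvector: after interchanging the sums, Q^T C Q w
      contains the factor Qw. The vectors u and v below are read off from \<theta> so that
      \<open>coord\<close> gives Qu = Qv = 0.\<close>
    have "A *\<^sub>v w = \<theta> (p,p) \<cdot>\<^sub>v w"
      if w: "w \<in> carrier_vec n" and zero: "\<And>l. l \<in> R \<Longrightarrow> (\<Sum>j<n. degen_coord p q \<theta> l j * w $ j) = 0" for w
      unfolding eig[OF w]
    proof (intro allI impI)
      fix i assume i: "i < n"
      have "(\<Sum>j<n. (A $$ (i,j) - of_bool (i = j) * \<theta> (p,p)) * w $ j) =
        (\<Sum>j<n. \<Sum>k\<in>R. \<Sum>l\<in>R. degen_coord p q \<theta> k i * \<theta> (upair k l) * (degen_coord p q \<theta> l j * w $ j))"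
        using AF i by (intro sum.cong refl)
          (simp add: degen_entry_def R_def sum_distrib_left sum_distrib_right ac_simps)
      also have "\<dots> = (\<Sum>k\<in>R. \<Sum>j<n. \<Sum>l\<in>R. degen_coord p q \<theta> k i * \<theta> (upair k l) * (degen_coord p q \<theta> l j * w $ j))"
        by (rule sum.swap)
      also have "\<dots> = (\<Sum>k\<in>R. \<Sum>l\<in>R. \<Sum>j<n. degen_coord p q \<theta> k i * \<theta> (upair k l) * (degen_coord p q \<theta> l j * w $ j))"
        by (intro sum.cong refl sum.swap)
      also have "\<dots> = (\<Sum>k\<in>R. \<Sum>l\<in>R. degen_coord p q \<theta> k i * \<theta> (upair k l) * (\<Sum>j<n. degen_coord p q \<theta> l j * w $ j))"
        by (simp only: sum_distrib_left)
      also have "\<dots> = 0" by (simp add: zero)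
      finally show "(\<Sum>j<n. (A $$ (i,j) - of_bool (i = j) * \<theta> (p,p)) * w $ j) = 0" .
    qed note ev = this
    have coord: "(\<Sum>j<n. degen_coord p q \<theta> l j * w j) = w l - \<theta> (upair l p) * w p - \<theta> (upair l q) * w q"
      if l: "l \<in> R" for l w
    proof -
      have "(\<Sum>j\<in>R. degen_coord p q \<theta> l j * w j) = (\<Sum>j\<in>R. if j = l then w l else 0)"
        by (intro sum.cong) (auto simp: degen_coord_def R_def)
      then show ?thesis using l unfolding sum_split_two[OF pq] R_def[symmetric]
        by (simp add: degen_coord_def R_def)
    qed
    define u where "u = vec n (\<lambda>k. if k = p then 1 else if k = q then 0 else \<theta> (upair k p))"
    define v where "v = vec n (\<lambda>k. if k = p then 0 else if k = q then 1 else \<theta> (upair k q))"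
    have "u \<in> carrier_vec n" "v \<in> carrier_vec n" by (auto simp: u_def v_def)
    moreover have "u $ p = 1" "u $ q = 0" "v $ p = 0" "v $ q = 1" using pq by (auto simp: u_def v_def)
    moreover have "A *\<^sub>v u = \<theta> (p,p) \<cdot>\<^sub>v u" "A *\<^sub>v v = \<theta> (p,p) \<cdot>\<^sub>v v"
      by (intro ev; use pq in \<open>auto simp: coord u_def v_def R_def\<close>)+
    ultimately show "\<exists>\<mu>. 2 \<le> order \<mu> (char_poly A)"
      using double_eigenvalue_iff[OF A sym] pq by blast
  qed
  then show ?thesis using eigval_strict_iff[OF A sym] by blast
qed

subsection \<open>Covering numbers of the degenerate matrices\<close>

text \<open>A grid of mesh s has at most 2 \<lceil>R/s\<rceil> + 1 values per coordinate, and s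
  times this is at most 2R + 3s. Rounding down can leave the box by up to s \<le> 1, which is why
  the centres are only confined to radius R + 1. That confinement is recorded because the Lipschitz
  estimate needs both points in one box.\<close>

lemma box_cover:
  fixes R s :: real
  assumes J: "finite J" and R: "0 \<le> R" and s: "0 < s" "s \<le> 1"
  shows "\<exists>\<Theta>. finite \<Theta> \<and> real (card \<Theta>) * s ^ card J \<le> (2 * R + 3) ^ card J \<and>
    (\<forall>\<theta>::'j \<Rightarrow> real. (\<forall>j\<in>J. \<bar>\<theta> j\<bar> \<le> R) \<longrightarrow>
      (\<exists>\<theta>'\<in>\<Theta>. (\<forall>j\<in>J. \<bar>\<theta>' j\<bar> \<le> R + 1) \<and> (\<forall>j\<in>J. \<bar>\<theta> j - \<theta>' j\<bar> \<le> s)))"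
proof -
  define m where "m = \<lceil>R / s\<rceil>"
  have m0: "0 \<le> m" using R s unfolding m_def by (simp add: ceiling_le_iff less_le_trans[of _ 0])
  define V where "V = (\<lambda>z::int. s * of_int z) ` {-m..m}"
  define \<Theta> where "\<Theta> = PiE J (\<lambda>_. V)"
  have fin: "finite V" unfolding V_def by simp
  have le: "2 * of_int m + 1 \<le> 2 * (R / s + 1) + 1"
    unfolding m_def by (intro add_right_mono mult_left_mono of_int_ceiling_le_add_one) simp
  have "card V \<le> nat (2 * m + 1)" unfolding V_def using card_image_le[of "{-m..m}"] by simp
  then have "real (card V) * s \<le> real (nat (2 * m + 1)) * s" using s by (intro mult_right_mono) auto
  also have "real (nat (2 * m + 1)) = 2 * of_int m + 1" using m0 by simp
  also have "\<dots> * s \<le> (2 * (R / s + 1) + 1) * s"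
    by (rule mult_right_mono[OF le]) (use s in simp)
  also have "\<dots> = 2 * R + 3 * s" using s by (simp add: field_simps)
  also have "\<dots> \<le> 2 * R + 3" using s by simp
  finally have cV: "real (card V) * s \<le> 2 * R + 3" .
  have "real (card \<Theta>) * s ^ card J = (real (card V) * s) ^ card J"
    unfolding \<Theta>_def using J by (simp add: card_PiE power_mult_distrib)
  also have "\<dots> \<le> (2 * R + 3) ^ card J" using cV s by (intro power_mono) auto
  finally have card: "real (card \<Theta>) * s ^ card J \<le> (2 * R + 3) ^ card J" .
  have "\<exists>\<theta>'\<in>\<Theta>. (\<forall>j\<in>J. \<bar>\<theta>' j\<bar> \<le> R + 1) \<and> (\<forall>j\<in>J. \<bar>\<theta> j - \<theta>' j\<bar> \<le> s)"
    if \<theta>: "\<forall>j\<in>J. \<bar>\<theta> j\<bar> \<le> R" for \<theta> :: "'j \<Rightarrow> real"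
  proof -
    define \<theta>' where "\<theta>' = (\<lambda>j\<in>J. s * of_int \<lfloor>\<theta> j / s\<rfloor>)"
    have close: "\<bar>\<theta> j - \<theta>' j\<bar> \<le> s" if "j \<in> J" for j
    proof -
      have "of_int \<lfloor>\<theta> j / s\<rfloor> * s \<le> \<theta> j" "\<theta> j < (of_int \<lfloor>\<theta> j / s\<rfloor> + 1) * s"
        using s floor_divide_lower[of s "\<theta> j"] floor_divide_upper[of s "\<theta> j"] by auto
      then show ?thesis using that unfolding \<theta>'_def by (simp add: algebra_simps)
    qed
    have "\<theta>' j \<in> V" if j: "j \<in> J" for j
    proof -
      have "\<lfloor>- (R / s)\<rfloor> \<le> \<lfloor>\<theta> j / s\<rfloor>" "\<lfloor>\<theta> j / s\<rfloor> \<le> \<lfloor>R / s\<rfloor>"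
        using \<theta> j s by (auto intro!: floor_mono simp: divide_right_mono abs_le_iff field_simps)
      then have "\<lfloor>\<theta> j / s\<rfloor> \<in> {-m..m}"
        unfolding m_def ceiling_def using floor_le_ceiling[of "R / s"] unfolding ceiling_def by simp
      then have "s * of_int \<lfloor>\<theta> j / s\<rfloor> \<in> V" unfolding V_def by (rule imageI)
      then show ?thesis using j unfolding \<theta>'_def by simp
    qed
    then have "\<theta>' \<in> \<Theta>" unfolding \<Theta>_def by (auto simp: \<theta>'_def)
    moreover have "\<bar>\<theta>' j\<bar> \<le> R + 1" if "j \<in> J" for j using close[OF that] \<theta> that s by fastforce
    ultimately show ?thesis using close by blast
  qed
  then show ?thesis using card fin J unfolding \<Theta>_def
    by (intro exI[of _ "PiE J (\<lambda>_. V)"]) (auto intro!: finite_PiE)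
qed

definition degen_index :: "nat \<Rightarrow> nat \<Rightarrow> nat \<Rightarrow> (nat \<times> nat) set" where
  "degen_index n p q = {(i, j). i \<le> j \<and> j < n} - {(q, q), (p, q)}"

lemma finite_upper_index: "finite {(i, j). i \<le> j \<and> j < (n::nat)}"
  by (rule finite_subset[of _ "{..<n} \<times> {..<n}"]) auto

lemma card_degen_index:
  assumes "p < q" "q < n"
  shows "card (degen_index n p q) = card {(i, j). i \<le> j \<and> j < n} - 2"
  unfolding degen_index_def using assms finite_upper_index[of n]
  by (subst card_Diff_subset) auto

text \<open>All coordinates read by \<open>degen_entry\<close> lie in the index set: apart from (p,
  p), each pair read has a member outside {p, q}, so the two removed pairs never occur.\<close>

lemma degen_index_mem:
  assumes "p < q" "q < n"
  shows "(p, p) \<in> degen_index n p q"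
    and "k \<in> {..<n} - {p, q} \<Longrightarrow> i < n \<Longrightarrow> upair k i \<in> degen_index n p q"
  using assms unfolding degen_index_def upair_def by (auto simp: min_def max_def)

text \<open>Each summand is a product of three factors bounded by R + 1, so telescoping bounds its
  change by 3 (R + 1)^2 s; there are at most n^2 summands, and the shift by \<mu> contributes one
  more s. The bound R + 1 rather than R allows for the entries 1 of
  \<open>degen_coord\<close>.\<close>

lemma degen_entry_lipschitz:
  assumes pq: "p < q" "q < n" and R: "0 \<le> R" and s: "0 \<le> s" and ij: "i < n" "j < n"
    and \<theta>: "\<And>k. k \<in> degen_index n p q \<Longrightarrow> \<bar>\<theta> k\<bar> \<le> R" "\<And>k. k \<in> degen_index n p q \<Longrightarrow> \<bar>\<theta>' k\<bar> \<le> R"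
    and close: "\<And>k. k \<in> degen_index n p q \<Longrightarrow> \<bar>\<theta> k - \<theta>' k\<bar> \<le> s"
  shows "\<bar>degen_entry n p q \<theta> i j - degen_entry n p q \<theta>' i j\<bar> \<le> (1 + 3 * (real n)\<^sup>2 * (R + 1)\<^sup>2) * s"
proof -
  let ?S = "{..<n} - {p, q}"
  note mem = degen_index_mem[OF pq]
  have triple: "\<bar>a * b * c - a' * b' * c'\<bar> \<le> 3 * (R + 1)\<^sup>2 * s"
    if "\<bar>a\<bar> \<le> R + 1" "\<bar>b\<bar> \<le> R + 1" "\<bar>c\<bar> \<le> R + 1" "\<bar>a'\<bar> \<le> R + 1" "\<bar>b'\<bar> \<le> R + 1" "\<bar>c'\<bar> \<le> R + 1"
      "\<bar>a - a'\<bar> \<le> s" "\<bar>b - b'\<bar> \<le> s" "\<bar>c - c'\<bar> \<le> s" for a b c a' b' c' :: real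
  proof -
    have "a * b * c - a' * b' * c' = (a - a') * (b * c) + (a' * c) * (b - b') + (a' * b') * (c - c')"
      by (simp add: algebra_simps)
    also have "\<bar>\<dots>\<bar> \<le> \<bar>(a - a') * (b * c)\<bar> + \<bar>(a' * c) * (b - b')\<bar> + \<bar>(a' * b') * (c - c')\<bar>"
      by (rule abs_triangle_ineq[THEN order_trans]) (rule add_right_mono[OF abs_triangle_ineq])
    also have "\<dots> = \<bar>a - a'\<bar> * (\<bar>b\<bar> * \<bar>c\<bar>) + (\<bar>a'\<bar> * \<bar>c\<bar>) * \<bar>b - b'\<bar> + (\<bar>a'\<bar> * \<bar>b'\<bar>) * \<bar>c - c'\<bar>"
      by (simp only: abs_mult)
    also have "\<dots> \<le> s * ((R + 1) * (R + 1)) + ((R + 1) * (R + 1)) * s + ((R + 1) * (R + 1)) * s"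
      by (intro add_mono mult_mono mult_nonneg_nonneg that abs_ge_zero s) (use R in simp_all)
    also have "\<dots> = 3 * (R + 1)\<^sup>2 * s" by (simp add: power2_eq_square algebra_simps)
    finally show ?thesis .
  qed
  have Q: "\<bar>degen_coord p q \<theta> k i\<bar> \<le> R + 1" "\<bar>degen_coord p q \<theta>' k i\<bar> \<le> R + 1"
    "\<bar>degen_coord p q \<theta> k i - degen_coord p q \<theta>' k i\<bar> \<le> s" if "k \<in> ?S" "i < n" for k i
    using \<theta>(1)[OF mem(2)[OF that]] \<theta>(2)[OF mem(2)[OF that]] close[OF mem(2)[OF that]] R s
    unfolding degen_coord_def by auto
  define c where "c = (of_bool (i = j) :: real)"
  define f where "f \<theta> k l = degen_coord p q \<theta> k i * degen_coord p q \<theta> l j * \<theta> (upair k l)" for \<theta> k l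
  have F: "degen_entry n p q \<theta> i j = c * \<theta> (p, p) + (\<Sum>k\<in>?S. \<Sum>l\<in>?S. f \<theta> k l)" for \<theta>
    unfolding degen_entry_def f_def c_def ..
  have "\<bar>(\<Sum>k\<in>?S. \<Sum>l\<in>?S. f \<theta> k l) - (\<Sum>k\<in>?S. \<Sum>l\<in>?S. f \<theta>' k l)\<bar> \<le> (\<Sum>k\<in>?S. \<Sum>l\<in>?S. \<bar>f \<theta> k l - f \<theta>' k l\<bar>)"
    unfolding sum_subtractf[symmetric] by (rule order_trans[OF sum_abs sum_mono[OF sum_abs]])
  also have "\<dots> \<le> (\<Sum>k\<in>?S. \<Sum>l\<in>?S. 3 * (R + 1)\<^sup>2 * s)"
  proof (intro sum_mono)
    fix k l assume kl: "k \<in> ?S" "l \<in> ?S"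
    then have "upair k l \<in> degen_index n p q" by (intro mem(2)) auto
    from \<theta>(1)[OF this] \<theta>(2)[OF this] close[OF this]
    have "\<bar>\<theta> (upair k l)\<bar> \<le> R + 1" "\<bar>\<theta>' (upair k l)\<bar> \<le> R + 1" "\<bar>\<theta> (upair k l) - \<theta>' (upair k l)\<bar> \<le> s"
      by simp_all
    with Q[OF kl(1) ij(1)] Q[OF kl(2) ij(2)] show "\<bar>f \<theta> k l - f \<theta>' k l\<bar> \<le> 3 * (R + 1)\<^sup>2 * s"
      unfolding f_def by (intro triple)
  qed
  also have "\<dots> = (real (card ?S))\<^sup>2 * (3 * (R + 1)\<^sup>2 * s)" by (simp add: power2_eq_square)
  also have "\<dots> \<le> (real n)\<^sup>2 * (3 * (R + 1)\<^sup>2 * s)"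
    using s card_mono[of "{..<n}" ?S] by (intro mult_right_mono power_mono) auto
  finally have sum: "\<bar>(\<Sum>k\<in>?S. \<Sum>l\<in>?S. f \<theta> k l) - (\<Sum>k\<in>?S. \<Sum>l\<in>?S. f \<theta>' k l)\<bar> \<le> (real n)\<^sup>2 * (3 * (R + 1)\<^sup>2 * s)" .
  have "\<bar>c * \<theta> (p, p) - c * \<theta>' (p, p)\<bar> \<le> s"
    using close[OF mem(1)] s unfolding c_def by auto
  moreover have "(1 + 3 * (real n)\<^sup>2 * (R + 1)\<^sup>2) * s = s + (real n)\<^sup>2 * (3 * (R + 1)\<^sup>2 * s)"
    by (simp add: distrib_right mult.assoc mult.left_commute)
  ultimately show ?thesis using sum unfolding F by linarith
qed

lemma degen_entry_cong:
  assumes pq: "p < q" "q < n" and ij: "i < n" "j < n"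
    and eq: "\<And>k. k \<in> degen_index n p q \<Longrightarrow> \<theta> k = \<theta>' k"
  shows "degen_entry n p q \<theta> i j = degen_entry n p q \<theta>' i j"
  using degen_index_mem[OF pq] ij eq unfolding degen_entry_def degen_coord_def
  by (intro arg_cong2[of _ _ _ _ "(+)"] sum.cong refl arg_cong2[of _ _ _ _ "(*)"]) auto

text \<open>Pinning the other coordinates to 0 makes the box a product of compact sets over all
  pairs, hence compact by Tychonoff in the full function space. Its continuous image is then closed,
  as measurability of hitting events requires.\<close>

definition degen_box :: "nat \<Rightarrow> nat \<Rightarrow> nat \<Rightarrow> real \<Rightarrow> (nat \<times> nat \<Rightarrow> real) set" where
  "degen_box n p q R = PiE UNIV (\<lambda>k. if k \<in> degen_index n p q then {-R..R} else {0})"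

definition degen_set :: "nat \<Rightarrow> nat \<Rightarrow> nat \<Rightarrow> real \<Rightarrow> (nat \<times> nat \<Rightarrow> real) set" where
  "degen_set n p q R =
     (\<lambda>\<theta>. \<lambda>(i, j). if i \<le> j \<and> j < n then degen_entry n p q \<theta> i j else 0) ` degen_box n p q R"

lemma closed_degen_set: "closed (degen_set n p q R)"
proof -
  have "compact (degen_box n p q R)"
  proof -
    have "compactin (product_topology (\<lambda>_. euclidean) UNIV) (degen_box n p q R)"
      unfolding degen_box_def compactin_PiE by auto
    then show ?thesis by (simp add: euclidean_product_topology)
  qed
  moreover have "continuous_on (degen_box n p q R)
      (\<lambda>\<theta>. \<lambda>(i, j). if i \<le> j \<and> j < n then degen_entry n p q \<theta> i j else 0)"
  proof (rule continuous_on_coordinatewise_then_product)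
    fix ij :: "nat \<times> nat"
    obtain i j where ij: "ij = (i, j)" by fastforce
    have co: "continuous_on S (\<lambda>\<theta>::nat \<times> nat \<Rightarrow> real. \<theta> k)" for S k
      by (rule continuous_on_subset[OF continuous_on_product_coordinates]) simp
    have cc: "continuous_on S (\<lambda>\<theta>. degen_coord p q \<theta> k i)" for S k i
      unfolding degen_coord_def by (cases "i \<in> {p, q}") (auto intro!: continuous_intros co)
    show "continuous_on (degen_box n p q R) (\<lambda>\<theta>. (case ij of (i, j) \<Rightarrow> if i \<le> j \<and> j < n then degen_entry n p q \<theta> i j else 0))"
      unfolding ij degen_entry_def by (cases "i \<le> j \<and> j < n") (auto intro!: continuous_intros co cc)
  qed
  ultimately show ?thesis unfolding degen_set_def
    by (intro compact_imp_closed compact_continuous_image)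
qed

text \<open>The parameters have no a priori bound, so the degenerate matrices are a countable union
  over integer radii. Coordinates outside the index set can be reset to 0 without changing any
  entry.\<close>

lemma degenerate_iff_degen_set:
  assumes pq: "p < q" "q < n"
  shows "(\<exists>\<theta>. \<forall>i j. i \<le> j \<and> j < n \<longrightarrow> a i j = degen_entry n p q \<theta> i j) \<longleftrightarrow>
    (\<exists>R::nat. (\<lambda>(i, j). if i \<le> j \<and> j < n then a i j else 0) \<in> degen_set n p q (real R))"
proof
  assume "\<exists>\<theta>. \<forall>i j. i \<le> j \<and> j < n \<longrightarrow> a i j = degen_entry n p q \<theta> i j"
  then obtain \<theta> where \<theta>: "\<And>i j. i \<le> j \<Longrightarrow> j < n \<Longrightarrow> a i j = degen_entry n p q \<theta> i j" by blast
  let ?J = "degen_index n p q"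
  have fin: "finite ?J" unfolding degen_index_def using finite_upper_index[of n] by simp
  obtain R where R: "(\<Sum>k\<in>?J. \<bar>\<theta> k\<bar>) \<le> real R" using real_arch_simple by blast
  define \<theta>' where "\<theta>' k = (if k \<in> ?J then \<theta> k else 0)" for k
  have "\<bar>\<theta> k\<bar> \<le> real R" if "k \<in> ?J" for k
    using member_le_sum[OF that, of "\<lambda>k. \<bar>\<theta> k\<bar>"] fin R by simp
  then have "\<theta>' \<in> degen_box n p q (real R)"
    unfolding degen_box_def \<theta>'_def by (auto simp: PiE_UNIV_domain abs_le_iff) (metis minus_le_iff)
  moreover have "(\<lambda>(i, j). if i \<le> j \<and> j < n then a i j else 0) =
      (\<lambda>(i, j). if i \<le> j \<and> j < n then degen_entry n p q \<theta>' i j else 0)"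
    using \<theta> degen_entry_cong[OF pq, of _ _ \<theta> \<theta>'] by (auto simp: fun_eq_iff \<theta>'_def)
  ultimately show "\<exists>R::nat. (\<lambda>(i, j). if i \<le> j \<and> j < n then a i j else 0) \<in> degen_set n p q (real R)"
    unfolding degen_set_def by blast
next
  assume "\<exists>R::nat. (\<lambda>(i, j). if i \<le> j \<and> j < n then a i j else 0) \<in> degen_set n p q (real R)"
  then obtain \<theta> where eq: "(\<lambda>(i, j). if i \<le> j \<and> j < n then a i j else 0) =
      (\<lambda>(i, j). if i \<le> j \<and> j < n then degen_entry n p q \<theta> i j else 0)"
    unfolding degen_set_def by blast
  have "a i j = degen_entry n p q \<theta> i j" if "i \<le> j" "j < n" for i j
    using fun_cong[OF eq, of "(i, j)"] that by simp
  then show "\<exists>\<theta>. \<forall>i j. i \<le> j \<and> j < n \<longrightarrow> a i j = degen_entry n p q \<theta> i j" by blast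
qed

text \<open>The grid of the parameter box is pushed forward by a Lipschitz map. The box has exactly
  two coordinates fewer than the upper triangle has entries, which gives the exponent;
  \<open>B\<close> does not depend on r.\<close>

lemma degen_set_cover:
  assumes pq: "p < q" "q < n" and R: "0 \<le> R"
  shows "\<exists>B. \<forall>r. 0 < r \<longrightarrow> r \<le> 1 \<longrightarrow> (\<exists>G. finite G \<and>
    real (card G) * r ^ (card {(i, j). i \<le> j \<and> j < n} - 2) \<le> B \<and>
    (\<forall>z\<in>degen_set n p q R. \<exists>g\<in>G. \<forall>k\<in>{(i, j). i \<le> j \<and> j < n}. \<bar>z k - g k\<bar> \<le> r))"
proof -
  let ?J = "degen_index n p q" and ?I = "{(i, j). i \<le> j \<and> j < n}"
  \<comment> \<open>The Lipschitz constant for radius R + 1, the radius that contains the grid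
    points as well.\<close>
  define L where "L = 1 + 3 * (real n)\<^sup>2 * (R + 1 + 1)\<^sup>2"
  have L: "1 \<le> L" unfolding L_def by simp
  have finJ: "finite ?J" unfolding degen_index_def using finite_upper_index[of n] by simp
  define F where "F \<theta> = (\<lambda>(i, j). degen_entry n p q \<theta> i j)" for \<theta>
  have "\<exists>G. finite G \<and> real (card G) * r ^ (card ?I - 2) \<le> ((2 * R + 3) * L) ^ card ?J \<and>
    (\<forall>z\<in>degen_set n p q R. \<exists>g\<in>G. \<forall>k\<in>?I. \<bar>z k - g k\<bar> \<le> r)" if r: "0 < r" "r \<le> 1" for r
  proof -
    define s where "s = r / L"
    have s: "0 < s" "s \<le> 1" "L * s = r" using r L unfolding s_def by (auto simp: field_simps)
    obtain \<Theta> where \<Theta>: "finite \<Theta>" "real (card \<Theta>) * s ^ card ?J \<le> (2 * R + 3) ^ card ?J"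
      "\<And>\<theta>. \<forall>k\<in>?J. \<bar>\<theta> k\<bar> \<le> R \<Longrightarrow>
        \<exists>\<theta>'\<in>\<Theta>. (\<forall>k\<in>?J. \<bar>\<theta>' k\<bar> \<le> R + 1) \<and> (\<forall>k\<in>?J. \<bar>\<theta> k - \<theta>' k\<bar> \<le> s)"
      using box_cover[OF finJ R s(1,2)] by metis
    have "real (card (F ` \<Theta>)) * r ^ (card ?I - 2) \<le> real (card \<Theta>) * r ^ card ?J"
      using \<Theta>(1) r card_degen_index[OF pq] by (auto intro!: mult_right_mono card_image_le)
    also have "\<dots> = real (card \<Theta>) * s ^ card ?J * L ^ card ?J"
      unfolding s(3)[symmetric] by (simp add: power_mult_distrib ac_simps)
    also have "\<dots> \<le> (2 * R + 3) ^ card ?J * L ^ card ?J"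
      using \<Theta>(2) L by (intro mult_right_mono) auto
    finally have card: "real (card (F ` \<Theta>)) * r ^ (card ?I - 2) \<le> ((2 * R + 3) * L) ^ card ?J"
      by (simp add: power_mult_distrib)
    have "\<exists>g\<in>F ` \<Theta>. \<forall>k\<in>?I. \<bar>z k - g k\<bar> \<le> r" if z: "z \<in> degen_set n p q R" for z
    proof -
      obtain \<theta> where \<theta>: "\<theta> \<in> degen_box n p q R"
        "z = (\<lambda>(i, j). if i \<le> j \<and> j < n then degen_entry n p q \<theta> i j else 0)"
        using z unfolding degen_set_def by blast
      have \<theta>R: "\<bar>\<theta> k\<bar> \<le> R" if "k \<in> ?J" for k
        using PiE_mem[OF \<theta>(1)[unfolded degen_box_def], of k] that by (auto simp: abs_le_iff)
      then obtain \<theta>' where \<theta>': "\<theta>' \<in> \<Theta>" "\<And>k. k \<in> ?J \<Longrightarrow> \<bar>\<theta>' k\<bar> \<le> R + 1" "\<And>k. k \<in> ?J \<Longrightarrow> \<bar>\<theta> k - \<theta>' k\<bar> \<le> s"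
        using \<Theta>(3)[of \<theta>] by blast
      have "\<bar>degen_entry n p q \<theta> i j - degen_entry n p q \<theta>' i j\<bar> \<le> r" if "i \<le> j" "j < n" for i j
        using degen_entry_lipschitz[OF pq, of "R + 1" s i j \<theta> \<theta>'] \<theta>R \<theta>' R s that
        unfolding L_def[symmetric] s(3) by fastforce
      then show ?thesis using \<theta>'(1) unfolding \<theta>(2) F_def by auto
    qed
    then show ?thesis using card \<Theta>(1) by (intro exI[of _ "F ` \<Theta>"]) auto
  qed
  then show ?thesis by blast
qed

subsection \<open>Hitting probabilities of continuous processes\<close>

text \<open>By compactness the distance to C attains its minimum over K, so C is hit iff the infimum
  of the distance is 0. By continuity this infimum may be taken over a countable dense set of
  times.\<close>

lemma hitting_event_measurable:
  fixes Z :: "'t::{metric_space, second_countable_topology} \<Rightarrow> 'a \<Rightarrow> 'b::metric_space"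
  assumes K: "compact K" and C: "closed C"
    and meas: "\<And>t. t \<in> K \<Longrightarrow> Z t \<in> borel_measurable M"
    and cont: "\<And>\<omega>. \<omega> \<in> space M \<Longrightarrow> continuous_on K (\<lambda>t. Z t \<omega>)"
  shows "{\<omega> \<in> space M. \<exists>t\<in>K. Z t \<omega> \<in> C} \<in> sets M"
proof (cases "K = {} \<or> C = {}")
  case False
  then have ne: "K \<noteq> {}" "C \<noteq> {}" by auto
  obtain T where T: "countable T" "T \<subseteq> K" "K \<subseteq> closure T" using separable by blast
  then have clT: "closure T = K" using K by (simp add: closure_minimal compact_imp_closed subset_antisym)
  define f where "f t \<omega> = infdist (Z t \<omega>) C" for t \<omega>
  have "(\<exists>t\<in>K. Z t \<omega> \<in> C) \<longleftrightarrow> (\<forall>l. \<exists>t\<in>T. f t \<omega> < 1 / real (Suc l))" if \<omega>: "\<omega> \<in> space M" for \<omega>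
  proof -
    have fc: "continuous_on K (\<lambda>t. f t \<omega>)" unfolding f_def by (intro continuous_intros cont \<omega>)
    show ?thesis
    proof
      assume "\<exists>t\<in>K. Z t \<omega> \<in> C"
      then obtain t where t: "t \<in> K" "f t \<omega> = 0" unfolding f_def by auto
      show "\<forall>l. \<exists>t\<in>T. f t \<omega> < 1 / real (Suc l)"
      proof (rule ccontr)
        assume "\<not> ?thesis"
        then obtain l where "\<And>t. t \<in> T \<Longrightarrow> 1 / real (Suc l) \<le> f t \<omega>" by (auto simp: not_less)
        then have "1 / real (Suc l) \<le> f t \<omega>"
          using continuous_ge_on_closure[of T "\<lambda>t. f t \<omega>" t "1 / real (Suc l)"] fc t clT by auto
        then show False using t by simp
      qed
    next
      assume small: "\<forall>l. \<exists>t\<in>T. f t \<omega> < 1 / real (Suc l)"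
      obtain t where t: "t \<in> K" "\<And>u. u \<in> K \<Longrightarrow> f t \<omega> \<le> f u \<omega>"
        using continuous_attains_inf[OF K ne(1) fc] by blast
      have "f t \<omega> \<le> 0"
      proof (rule ccontr)
        assume "\<not> f t \<omega> \<le> 0"
        then obtain l where "1 / real (Suc l) < f t \<omega>" using nat_approx_posE[of "f t \<omega>"] by auto
        then show False using small t T(2) by (meson less_le_trans less_asym subsetD)
      qed
      then have "f t \<omega> = 0" unfolding f_def using infdist_nonneg[of "Z t \<omega>" C] by simp
      then show "\<exists>t\<in>K. Z t \<omega> \<in> C"
        using t(1) in_closed_iff_infdist_zero[OF C ne(2)] unfolding f_def by blast
    qed
  qed
  then have "{\<omega> \<in> space M. \<exists>t\<in>K. Z t \<omega> \<in> C} = {\<omega> \<in> space M. \<forall>l. \<exists>t\<in>T. f t \<omega> < 1 / real (Suc l)}" by blast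
  also have "\<dots> \<in> sets M"
  proof -
    have [measurable]: "f t \<in> borel_measurable M" if "t \<in> T" for t
      unfolding f_def using meas[of t] T(2) that
      by (intro borel_measurable_continuous_on[where f = "\<lambda>z. infdist z C"] continuous_intros) auto
    show ?thesis using T(1) by measurable
  qed
  finally show ?thesis .
qed auto

text \<open>The level-j dyadic floors of t converge to t, and successive floors differ by at most
  one dyadic step. Summing the geometric series from level m on bounds the distance to the level-m
  value.\<close>

lemma dyadic_chaining:
  fixes f :: "real \<Rightarrow> real"
  assumes cont: "continuous_on {0..1} f" and \<rho>: "0 \<le> \<rho>" "\<rho> < 1"
    and step: "\<And>j k. m \<le> j \<Longrightarrow> k < 2 ^ j \<Longrightarrow> \<bar>f (real (Suc k) / 2 ^ j) - f (real k / 2 ^ j)\<bar> \<le> \<rho> ^ j"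
    and t: "t \<in> {0..1}"
  shows "\<bar>f t - f (real (nat \<lfloor>2 ^ m * t\<rfloor>) / 2 ^ m)\<bar> \<le> \<rho> ^ m / (1 - \<rho>)"
proof -
  define a where "a j = nat \<lfloor>2 ^ j * t\<rfloor>" for j
  define \<tau> where "\<tau> j = real (a j) / 2 ^ j" for j
  have a: "real (a j) \<le> 2 ^ j * t" "2 ^ j * t < real (a j) + 1" for j
    using t unfolding a_def by auto
  have \<tau>: "\<tau> j \<le> t" "t < \<tau> j + 1 / 2 ^ j" "0 \<le> \<tau> j" for j
    using a[of j] unfolding \<tau>_def by (auto simp: field_simps)
  have a_Suc: "a (Suc j) = 2 * a j \<or> a (Suc j) = Suc (2 * a j)" for j
  proof -
    have "real (a (Suc j)) < real (2 * a j + 2)" "real (2 * a j) < real (a (Suc j) + 1)"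
      using a[of j] a[of "Suc j"] by auto
    then show ?thesis by (simp only: of_nat_less_iff) arith
  qed
  have inc: "\<bar>f (\<tau> (Suc j)) - f (\<tau> j)\<bar> \<le> \<rho> ^ j" if "m \<le> j" for j
    using a_Suc[of j]
  proof
    assume "a (Suc j) = 2 * a j"
    then show ?thesis using \<rho> by (simp add: \<tau>_def)
  next
    assume eq: "a (Suc j) = Suc (2 * a j)"
    \<comment> \<open>This keeps the step inside [0, 1]: at t = 1 the floor is already the right
      endpoint, but then the even case applies.\<close>
    have "real (Suc (2 * a j)) \<le> 2 ^ Suc j * 1"
      using a(1)[of "Suc j"] t unfolding eq by (meson atLeastAtMost_iff mult_left_mono order_trans zero_le_numeral zero_le_power)
    then have "2 * a j < 2 ^ Suc j"
      by (metis Suc_le_lessD mult.right_neutral of_nat_le_iff of_nat_numeral of_nat_power)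
    then have "\<bar>f (real (Suc (2 * a j)) / 2 ^ Suc j) - f (real (2 * a j) / 2 ^ Suc j)\<bar> \<le> \<rho> ^ Suc j"
      using that by (intro step) auto
    moreover have "\<rho> ^ Suc j \<le> \<rho> ^ j" using \<rho> by (intro power_decreasing) auto
    ultimately show ?thesis by (simp add: \<tau>_def eq)
  qed
  have sum: "\<bar>f (\<tau> (m + i)) - f (\<tau> m)\<bar> \<le> (\<Sum>l<i. \<rho> ^ (m + l))" for i
  proof (induction i)
    case (Suc i)
    then show ?case using inc[of "m + i"] by simp
  qed simp
  have "(\<Sum>l<i. \<rho> ^ (m + l)) \<le> \<rho> ^ m / (1 - \<rho>)" for i
  proof -
    have "(\<Sum>l<i. \<rho> ^ (m + l)) = \<rho> ^ m * (\<Sum>l<i. \<rho> ^ l)" by (simp add: power_add sum_distrib_left)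
    also have "(\<Sum>l<i. \<rho> ^ l) = (1 - \<rho> ^ i) / (1 - \<rho>)" using \<rho> by (simp add: sum_gp_strict)
    also have "\<rho> ^ m * ((1 - \<rho> ^ i) / (1 - \<rho>)) \<le> \<rho> ^ m * (1 / (1 - \<rho>))"
      using \<rho> by (intro mult_left_mono divide_right_mono) auto
    finally show ?thesis by simp
  qed
  then have bound: "\<bar>f (\<tau> (m + i)) - f (\<tau> m)\<bar> \<le> \<rho> ^ m / (1 - \<rho>)" for i
    using sum[of i] order_trans by blast
  have "\<tau> \<longlonglongrightarrow> t"
  proof (rule tendsto_sandwich[of "\<lambda>j. t - (1 / 2) ^ j" _ _ "\<lambda>_. t"])
    show "(\<lambda>j. t - (1 / 2) ^ j) \<longlonglongrightarrow> t"
      by (rule tendsto_eq_intros | rule LIMSEQ_power_zero | simp)+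
  qed (use \<tau> in \<open>auto intro!: always_eventually simp: power_one_over algebra_simps less_imp_le\<close>)
  then have "(\<lambda>i. \<tau> (m + i)) \<longlonglongrightarrow> t" by (rule LIMSEQ_ignore_initial_segment[of _ _ m, folded add.commute[of m]])
  moreover have "\<tau> j \<in> {0..1}" for j using \<tau>(1,3)[of j] t by simp
  ultimately have "(\<lambda>i. f (\<tau> (m + i))) \<longlonglongrightarrow> f t"
    by (intro continuous_on_tendsto_compose[OF cont _ t] always_eventually) auto
  then have "(\<lambda>i. \<bar>f (\<tau> (m + i)) - f (\<tau> m)\<bar>) \<longlonglongrightarrow> \<bar>f t - f (\<tau> m)\<bar>"
    by (intro tendsto_intros)
  then have "\<bar>f t - f (\<tau> m)\<bar> \<le> \<rho> ^ m / (1 - \<rho>)"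
    by (rule LIMSEQ_le_const2) (use bound in blast)
  then show ?thesis by (simp add: \<tau>_def a_def)
qed

text \<open>\<open>cover\<close> says that D has upper box dimension at most
  \<open>card I - 2\<close>. Times are combined by union bounds, so \<open>indep\<close> and
  \<open>small\<close> speak of one fixed time. \<open>S\<close> is any event on which D is hit,
  which separates the estimate from the measurability question.\<close>

lemma (in prob_space) hitting_prob_zero:
  fixes Y :: "'i \<Rightarrow> real \<Rightarrow> 'a \<Rightarrow> real" and D :: "('i \<Rightarrow> real) set"
  assumes I: "finite I" "2 \<le> card I"
    and meas: "\<And>i t. i \<in> I \<Longrightarrow> t \<in> {0..1} \<Longrightarrow> random_variable borel (Y i t)"
    and cont: "\<And>i \<omega>. i \<in> I \<Longrightarrow> \<omega> \<in> space M \<Longrightarrow> continuous_on {0..1} (\<lambda>t. Y i t \<omega>)"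
    and indep: "\<And>t g r. t \<in> {0..1} \<Longrightarrow> prob {\<omega> \<in> space M. \<forall>i\<in>I. \<bar>Y i t \<omega> - g i\<bar> \<le> r}
       = (\<Prod>i\<in>I. prob {\<omega> \<in> space M. \<bar>Y i t \<omega> - g i\<bar> \<le> r})"
    and small: "\<And>i t c r. i \<in> I \<Longrightarrow> t \<in> {0..1} \<Longrightarrow> 0 \<le> r \<Longrightarrow>
       prob {\<omega> \<in> space M. \<bar>Y i t \<omega> - c\<bar> \<le> r} \<le> K * r"
    and incr: "\<And>i s t. i \<in> I \<Longrightarrow> 0 \<le> s \<Longrightarrow> s < t \<Longrightarrow> t \<le> 1 \<Longrightarrow>
       prob {\<omega> \<in> space M. (t - s) powr \<beta> < \<bar>Y i t \<omega> - Y i s \<omega>\<bar>} \<le> C * (t - s) powr (1 + \<kappa>)"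
    and \<beta>: "1 / 2 < \<beta>" and \<kappa>: "0 < \<kappa>"
    and cover: "\<And>r. 0 < r \<Longrightarrow> r \<le> 1 \<Longrightarrow> \<exists>G. finite G \<and> real (card G) * r ^ (card I - 2) \<le> B \<and>
       (\<forall>z\<in>D. \<exists>g\<in>G. \<forall>i\<in>I. \<bar>z i - g i\<bar> \<le> r)"
    and S: "S \<in> events" "\<And>\<omega>. \<omega> \<in> S \<Longrightarrow> \<exists>t\<in>{0..1}. \<exists>z\<in>D. \<forall>i\<in>I. Y i t \<omega> = z i"
  shows "prob S = 0"
proof -
  define n where "n = card I"
  \<comment> \<open>\<rho>^j is the allowed increment at level j. \<sigma>^j is the order of the
    probability that some of the 2^j increments exceeds it, and \<tau>^m = 2^m \<rho>^(2m) that of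
    being near D at some level-m time. The inequality \<tau> < 1 is where \<beta> > 1/2
    enters.\<close>
  define \<rho> where "\<rho> = (2::real) powr (- \<beta>)"
  define \<sigma> where "\<sigma> = (2::real) powr (- \<kappa>)"
  define \<tau> where "\<tau> = (2::real) powr (1 - 2 * \<beta>)"
  have \<rho>: "0 < \<rho>" "\<rho> < 1" and \<sigma>: "0 < \<sigma>" "\<sigma> < 1" and \<tau>: "0 < \<tau>" "\<tau> < 1"
    using \<beta> \<kappa> powr_less_mono[of "- \<beta>" 0 2] powr_less_mono[of "- \<kappa>" 0 2] powr_less_mono[of "1 - 2 * \<beta>" 0 2]
    unfolding \<rho>_def \<sigma>_def \<tau>_def by (simp_all del: powr_less_cancel_iff)
  have dy: "(1 / 2 ^ j) powr x = (2 powr (- x)) ^ j" for j and x :: real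
  proof -
    have "1 / 2 ^ j = (2::real) powr (- real j)" by (simp add: powr_minus_divide powr_realpow)
    moreover have "(2 powr (- x)) ^ j = (2 powr (- x)) powr real j" by (simp add: powr_realpow)
    ultimately show ?thesis by (simp add: powr_powr mult.commute)
  qed
  have pow2\<sigma>: "2 ^ j * (2 powr (- (1 + \<kappa>))) ^ j = \<sigma> ^ j" for j
  proof -
    have "2 * 2 powr (- (1 + \<kappa>)) = 2 powr (1 + (- (1 + \<kappa>)))" by (simp only: powr_add) simp
    then have "2 * 2 powr (- (1 + \<kappa>)) = \<sigma>" unfolding \<sigma>_def by simp
    then show ?thesis by (metis power_mult_distrib)
  qed
  have pow2\<tau>: "2 ^ j * (\<rho> ^ j)\<^sup>2 = \<tau> ^ j" for j
  proof -
    have "2 * \<rho>\<^sup>2 = 2 powr 1 * (2 powr (- \<beta>) * 2 powr (- \<beta>))" unfolding \<rho>_def by (simp add: power2_eq_square)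
    also have "\<dots> = \<tau>" unfolding \<tau>_def powr_add[symmetric] by simp
    finally have "2 ^ j * (\<rho>\<^sup>2) ^ j = \<tau> ^ j" by (metis power_mult_distrib)
    then show ?thesis by (simp only: power_mult[symmetric] mult.commute[of j])
  qed
  have n2: "(n - 2) + 2 = n" using I unfolding n_def by simp
  obtain i0 where i0: "i0 \<in> I" using I by fastforce
  have "0 \<le> C" using order_trans[OF measure_nonneg incr[OF i0, of 0 1]] by simp
  have "0 \<le> K" using order_trans[OF measure_nonneg small[OF i0, of 0 1]] by simp
  obtain G1 :: "('i \<Rightarrow> real) set" where "real (card G1) * 1 ^ (card I - 2) \<le> B" using cover[of 1] by auto
  then have "0 \<le> B" using order_trans[OF of_nat_0_le_iff[of "card G1"], of B] by simp
  define V where "V i j k = {\<omega> \<in> space M. \<rho> ^ j < \<bar>Y i (real (Suc k) / 2 ^ j) \<omega> - Y i (real k / 2 ^ j) \<omega>\<bar>}" for i j k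
  define E where "E j = (\<Union>i\<in>I. \<Union>k<2 ^ j. V i j k)" for j
  have dyadic01: "real k / 2 ^ j \<in> {0..1}" if "k \<le> 2 ^ j" for k j :: nat
  proof -
    have "real k \<le> real (2 ^ j)" using that by (simp only: of_nat_le_iff)
    then show ?thesis by simp
  qed
  have V: "V i j k \<in> events" "prob (V i j k) \<le> C * (2 powr (- (1 + \<kappa>))) ^ j"
    if "i \<in> I" "k < 2 ^ j" for i j k
  proof -
    have [measurable]: "Y i (real (Suc k) / 2 ^ j) \<in> borel_measurable M" "Y i (real k / 2 ^ j) \<in> borel_measurable M"
      using that by (intro meas dyadic01; simp)+
    show "V i j k \<in> events" unfolding V_def by measurable
    have eq: "real (Suc k) / 2 ^ j - real k / 2 ^ j = 1 / 2 ^ j" by (simp add: diff_divide_distrib[symmetric])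
    show "prob (V i j k) \<le> C * (2 powr (- (1 + \<kappa>))) ^ j"
      using incr[OF that(1), of "real k / 2 ^ j" "real (Suc k) / 2 ^ j"] dyadic01[of "Suc k" j] that
      unfolding eq dy V_def \<rho>_def by (auto simp: divide_strict_right_mono)
  qed
  have E: "E j \<in> events" for j unfolding E_def using V I by (intro sets.finite_UN) auto
  have PE: "prob (E j) \<le> real n * C * \<sigma> ^ j" for j
  proof -
    have "prob (E j) \<le> (\<Sum>i\<in>I. prob (\<Union>k<2 ^ j. V i j k))"
      unfolding E_def using V I by (intro finite_measure_subadditive_finite) auto
    also have "\<dots> \<le> (\<Sum>i\<in>I. \<Sum>k<(2::nat) ^ j. prob (V i j k))"
      using V by (intro sum_mono finite_measure_subadditive_finite) auto
    also have "\<dots> \<le> (\<Sum>i\<in>I. \<Sum>k<(2::nat) ^ j. C * (2 powr (- (1 + \<kappa>))) ^ j)"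
      using V by (intro sum_mono) auto
    also have "\<dots> = real n * C * (2 ^ j * (2 powr (- (1 + \<kappa>))) ^ j)"
      by (simp add: n_def)
    finally show ?thesis unfolding pow2\<sigma> .
  qed
  \<comment> \<open>The first term is the chaining error up to the nearby dyadic time, the second
    the radius of the covering balls, both in units of \<rho>^m.\<close>
  define c where "c = 1 / (1 - \<rho>) + 1"
  have c: "0 < c" using \<rho> unfolding c_def by (simp add: add_pos_pos)
  have main: "prob S \<le> 2 * B * (K * c) ^ n * \<tau> ^ m + real n * C * \<sigma> ^ m / (1 - \<sigma>)" for m
  proof -
    have r: "0 < \<rho> ^ m" "\<rho> ^ m \<le> 1" using \<rho> by (auto simp: power_le_one)
    obtain G where G: "finite G" "real (card G) * (\<rho> ^ m) ^ (n - 2) \<le> B"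
      "\<And>z. z \<in> D \<Longrightarrow> \<exists>g\<in>G. \<forall>i\<in>I. \<bar>z i - g i\<bar> \<le> \<rho> ^ m"
      using cover[OF r] unfolding n_def by blast
    define W where "W k g = {\<omega> \<in> space M. \<forall>i\<in>I. \<bar>Y i (real k / 2 ^ m) \<omega> - g i\<bar> \<le> c * \<rho> ^ m}" for k g
    have W: "W k g \<in> events" "prob (W k g) \<le> (K * (c * \<rho> ^ m)) ^ n" if "k \<le> 2 ^ m" for k g
    proof -
      have [measurable]: "Y i (real k / 2 ^ m) \<in> borel_measurable M" if "i \<in> I" for i
        using \<open>k \<le> 2 ^ m\<close> that by (intro meas dyadic01)
      show "W k g \<in> events" unfolding W_def using I(1) by measurable
      have "prob (W k g) = (\<Prod>i\<in>I. prob {\<omega> \<in> space M. \<bar>Y i (real k / 2 ^ m) \<omega> - g i\<bar> \<le> c * \<rho> ^ m})"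
        unfolding W_def using that by (intro indep dyadic01)
      also have "\<dots> \<le> (\<Prod>i\<in>I. K * (c * \<rho> ^ m))"
        using that c r by (intro prod_mono conjI small dyadic01) auto
      finally show "prob (W k g) \<le> (K * (c * \<rho> ^ m)) ^ n" by (simp add: n_def)
    qed
    define F where "F = (\<Union>k\<le>2 ^ m. \<Union>g\<in>G. W k g)"
    have F: "F \<in> events" unfolding F_def using W G by (intro sets.finite_UN) auto
    have PF: "prob F \<le> 2 * B * (K * c) ^ n * \<tau> ^ m"
    proof -
      define x where "x = \<rho> ^ m"
      have x: "0 < x" using r unfolding x_def by simp
      define P where "P = (K * c) ^ n"
      have P: "0 \<le> P" using \<open>0 \<le> K\<close> c unfolding P_def by simp
      have "(K * (c * x)) ^ n = P * x ^ n" unfolding P_def power_mult_distrib by (simp only: mult.assoc)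
      \<comment> \<open>The first n - 2 powers absorb the number of covering balls; the two that
        remain compete with the number of dyadic times.\<close>
      also have "x ^ n = x ^ (n - 2) * x\<^sup>2" unfolding power_add[symmetric] n2 ..
      finally have Pn: "(K * (c * x)) ^ n = P * (x ^ (n - 2) * x\<^sup>2)" .
      have "prob F \<le> (\<Sum>k\<le>(2::nat) ^ m. prob (\<Union>g\<in>G. W k g))"
        unfolding F_def using W G by (intro finite_measure_subadditive_finite) auto
      also have "\<dots> \<le> (\<Sum>k\<le>(2::nat) ^ m. \<Sum>g\<in>G. prob (W k g))"
        using W G by (intro sum_mono finite_measure_subadditive_finite) auto
      also have "\<dots> \<le> (\<Sum>k\<le>(2::nat) ^ m. \<Sum>g\<in>G. P * (x ^ (n - 2) * x\<^sup>2))"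
        using W(2)[folded x_def, unfolded Pn] by (intro sum_mono) auto
      also have "\<dots> = (2 ^ m + 1) * (real (card G) * (P * (x ^ (n - 2) * x\<^sup>2)))" by simp
      also have "\<dots> = (real (card G) * x ^ (n - 2)) * ((2 ^ m + 1) * (P * x\<^sup>2))" by (simp only: ac_simps)
      also have "\<dots> \<le> B * ((2 ^ m + 1) * (P * x\<^sup>2))"
        using G(2) P unfolding x_def by (intro mult_right_mono) auto
      also have "\<dots> \<le> B * ((2 * 2 ^ m) * (P * x\<^sup>2))"
        using \<open>0 \<le> B\<close> P by (intro mult_left_mono mult_right_mono) auto
      also have "\<dots> = 2 * B * P * (2 ^ m * x\<^sup>2)" by (simp only: ac_simps)
      finally show ?thesis unfolding x_def P_def pow2\<tau> .
    qed
    have sum: "summable (\<lambda>j. real n * C * \<sigma> ^ m * \<sigma> ^ j)" using \<sigma> by (intro summable_mult summable_geometric) simp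
    have PE': "prob (E (m + j)) \<le> real n * C * \<sigma> ^ m * \<sigma> ^ j" for j
      using PE[of "m + j"] by (simp add: power_add mult.assoc)
    have sumE: "summable (\<lambda>j. prob (E (m + j)))"
      by (rule summable_comparison_test'[OF sum, of 0]) (use PE' in \<open>auto simp: abs_of_nonneg\<close>)
    have "prob (\<Union>j. E (m + j)) \<le> (\<Sum>j. prob (E (m + j)))"
      using E sumE by (intro finite_measure_subadditive_countably) auto
    also have "\<dots> \<le> (\<Sum>j. real n * C * \<sigma> ^ m * \<sigma> ^ j)"
      by (intro suminf_le PE' sumE sum)
    also have "\<dots> = real n * C * \<sigma> ^ m / (1 - \<sigma>)"
      using \<sigma> by (subst suminf_mult) (auto simp: suminf_geometric summable_geometric)
    finally have PEU: "prob (\<Union>j. E (m + j)) \<le> real n * C * \<sigma> ^ m / (1 - \<sigma>)" .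
    \<comment> \<open>Off the events of large increments, a hit at time t puts the process close to
      some covering centre at the dyadic floor of t. For t = 1 this floor has index 2^m, hence the
      2^m + 1 times in \<open>F\<close>.\<close>
    have "S \<subseteq> F \<union> (\<Union>j. E (m + j))"
    proof
      fix \<omega> assume \<omega>: "\<omega> \<in> S"
      then have sp: "\<omega> \<in> space M" using S(1) sets.sets_into_space by blast
      obtain t z where t: "t \<in> {0..1}" and z: "z \<in> D" "\<And>i. i \<in> I \<Longrightarrow> Y i t \<omega> = z i"
        using S(2)[OF \<omega>] by blast
      show "\<omega> \<in> F \<union> (\<Union>j. E (m + j))"
      proof (cases "\<omega> \<in> (\<Union>j. E (m + j))")
        case False
        then have nE: "\<omega> \<notin> E j" if "m \<le> j" for j using that by (metis UN_I UNIV_I le_Suc_ex)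
        define k where "k = nat \<lfloor>2 ^ m * t\<rfloor>"
        have "\<lfloor>2 ^ m * t\<rfloor> \<le> \<lfloor>2 ^ m :: real\<rfloor>" using t by (intro floor_mono) (simp add: mult_left_le)
        also have "\<lfloor>2 ^ m :: real\<rfloor> = int (2 ^ m)" by (metis floor_of_nat of_nat_numeral of_nat_power)
        finally have k: "k \<le> 2 ^ m" unfolding k_def by simp
        obtain g where g: "g \<in> G" "\<And>i. i \<in> I \<Longrightarrow> \<bar>z i - g i\<bar> \<le> \<rho> ^ m" using G(3)[OF z(1)] by blast
        have "\<bar>Y i (real k / 2 ^ m) \<omega> - g i\<bar> \<le> c * \<rho> ^ m" if i: "i \<in> I" for i
        proof -
          have "\<bar>Y i t \<omega> - Y i (real k / 2 ^ m) \<omega>\<bar> \<le> \<rho> ^ m / (1 - \<rho>)"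
            unfolding k_def
          proof (rule dyadic_chaining[OF cont[OF i sp] _ _ _ t])
            fix j k assume "m \<le> j" "k < (2::nat) ^ j"
            then show "\<bar>Y i (real (Suc k) / 2 ^ j) \<omega> - Y i (real k / 2 ^ j) \<omega>\<bar> \<le> \<rho> ^ j"
              using nE[of j] i sp unfolding E_def V_def by (force simp: not_less)
          qed (use \<rho> in auto)
          moreover have "c * \<rho> ^ m = \<rho> ^ m / (1 - \<rho>) + \<rho> ^ m" by (simp add: c_def algebra_simps)
          ultimately show ?thesis using g(2)[OF i] z(2)[OF i] by simp
        qed
        then have "\<omega> \<in> W k g" unfolding W_def using sp by simp
        then show ?thesis using k g unfolding F_def by blast
      qed simp
    qed
    then have "prob S \<le> prob (F \<union> (\<Union>j. E (m + j)))"
      using F E by (intro finite_measure_mono) auto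
    also have "\<dots> \<le> prob F + prob (\<Union>j. E (m + j))"
      using F E by (intro measure_Un_le) auto
    finally show ?thesis using PF PEU by simp
  qed
  have "(\<lambda>m. 2 * B * (K * c) ^ n * \<tau> ^ m + real n * C * \<sigma> ^ m / (1 - \<sigma>)) \<longlonglongrightarrow> 2 * B * (K * c) ^ n * 0 + real n * C * 0 / (1 - \<sigma>)"
    using \<sigma> \<tau> by (intro tendsto_intros LIMSEQ_power_zero) auto
  then have "prob S \<le> 2 * B * (K * c) ^ n * 0 + real n * C * 0 / (1 - \<sigma>)"
    by (rule LIMSEQ_le_const) (use main in blast)
  then show ?thesis using measure_nonneg[of M S] by simp
qed

subsection \<open>Centered Gaussian variables\<close>

lemma (in prob_space) centered_gaussian_cases:
  assumes g: "gaussian_rv M Z" and mean: "expectation Z = 0"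
  obtains (zero) "AE \<omega> in M. Z \<omega> = 0"
  | (normal) \<sigma> where "0 < \<sigma>" "distributed M lborel Z (normal_density 0 \<sigma>)"
proof -
  have [measurable]: "Z \<in> borel_measurable M" using g unfolding gaussian_rv_def by blast
  consider m where "distr M borel Z = return borel m"
    | m \<sigma> where "0 < \<sigma>" "distributed M lborel Z (normal_density m \<sigma>)"
    using g unfolding gaussian_rv_def by blast
  then show thesis
  proof cases
    case 1
    have "AE z in distr M borel Z. z = m" unfolding 1 by (simp add: AE_return)
    then have ae: "AE \<omega> in M. Z \<omega> = m" by (simp add: AE_distr_iff)
    then have "expectation Z = expectation (\<lambda>_. m)" by (intro integral_cong_AE) auto
    then have "m = 0" using mean by (simp add: prob_space)
    then show ?thesis using ae zero by simp
  next
    case 2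
    then have "m = 0" using normal_distributed_expectation[OF 2] mean by simp
    then show ?thesis using 2 normal by simp
  qed
qed

text \<open>The factor is the double factorial (2k - 1)!!. Using the second moment in place of
  \<sigma> lets one formula include the law concentrated at 0.\<close>

lemma (in prob_space) centered_gaussian_moment:
  assumes g: "gaussian_rv M Z" and mean: "expectation Z = 0"
  shows "integrable M (\<lambda>\<omega>. Z \<omega> ^ (2 * k))"
    and "expectation (\<lambda>\<omega>. Z \<omega> ^ (2 * k)) = fact (2 * k) / (2 ^ k * fact k) * expectation (\<lambda>\<omega>. (Z \<omega>)\<^sup>2) ^ k"
proof -
  have Z[measurable]: "Z \<in> borel_measurable M" using g unfolding gaussian_rv_def by blast
  have "integrable M (\<lambda>\<omega>. Z \<omega> ^ (2 * k)) \<and>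
    expectation (\<lambda>\<omega>. Z \<omega> ^ (2 * k)) = fact (2 * k) / (2 ^ k * fact k) * expectation (\<lambda>\<omega>. (Z \<omega>)\<^sup>2) ^ k"
    using g mean
  proof (cases rule: centered_gaussian_cases)
    case zero
    have eq: "AE \<omega> in M. Z \<omega> ^ j = 0 ^ j" for j using zero by auto
    then have "integrable M (\<lambda>\<omega>. Z \<omega> ^ j)" for j
      by (subst integrable_cong_AE[of _ _ "\<lambda>_. 0 ^ j"]) auto
    moreover have "expectation (\<lambda>\<omega>. Z \<omega> ^ j) = 0 ^ j" for j
      using eq[of j] by (subst integral_cong_AE[of _ _ "\<lambda>_. 0 ^ j"]) (auto simp: prob_space)
    ultimately show ?thesis by (cases k) (simp_all del: power_Suc add: prob_space)
  next
    case (normal \<sigma>)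
    have nn: "0 \<le> normal_density 0 \<sigma> z" for z by simp
    have int: "integrable M (\<lambda>\<omega>. Z \<omega> ^ (2 * k))" for k
      using distributed_integrable[OF normal(2), of "\<lambda>z. z ^ (2 * k)"] integrable_normal_moment[OF normal(1), of 0 "2 * k"]
      by simp
    have ex: "expectation (\<lambda>\<omega>. Z \<omega> ^ (2 * k)) = fact (2 * k) / ((2 / \<sigma>\<^sup>2) ^ k * fact k)" for k
      using distributed_integral[OF normal(2), of "\<lambda>z. z ^ (2 * k)"] integral_normal_moment_even[OF normal(1), of 0 k]
      by simp
    have "expectation (\<lambda>\<omega>. (Z \<omega>)\<^sup>2) = \<sigma>\<^sup>2" using ex[of 1] by simp
    then show ?thesis using int ex[of k] by (simp add: power_divide field_simps)
  qed
  then show "integrable M (\<lambda>\<omega>. Z \<omega> ^ (2 * k))"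
    and "expectation (\<lambda>\<omega>. Z \<omega> ^ (2 * k)) = fact (2 * k) / (2 ^ k * fact k) * expectation (\<lambda>\<omega>. (Z \<omega>)\<^sup>2) ^ k"
    by auto
qed

text \<open>A Bochner integral equal to 0 does not by itself entail integrability, and linearity of
  the expectation of increments needs it. The bound |z| \<le> 1 + z^2 reduces it to the second
  moment.\<close>

lemma (in prob_space) centered_gaussian_integrable:
  assumes g: "gaussian_rv M Z" and mean: "expectation Z = 0"
  shows "integrable M Z"
proof (rule Bochner_Integration.integrable_bound)
  show "integrable M (\<lambda>\<omega>. 1 + Z \<omega> ^ (2 * 1))"
    using centered_gaussian_moment(1)[OF g mean, of 1] by simp
  show "Z \<in> borel_measurable M" using g unfolding gaussian_rv_def by blast
  have "\<bar>z\<bar> \<le> 1 + z\<^sup>2" for z :: real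
    using zero_le_power2[of "\<bar>z\<bar> - 1 / 2"] by (simp add: power2_eq_square algebra_simps)
  then show "AE \<omega> in M. norm (Z \<omega>) \<le> norm (1 + Z \<omega> ^ (2 * 1))" by simp
qed

text \<open>Markov's inequality for the 2k-th power. The order k stays free: it is chosen later to
  make the exponent of the increment exceed 1.\<close>

lemma (in prob_space) centered_gaussian_tail:
  assumes g: "gaussian_rv M Z" and mean: "expectation Z = 0" and a: "0 < a"
  shows "prob {\<omega> \<in> space M. a < \<bar>Z \<omega>\<bar>} \<le>
    fact (2 * k) / (2 ^ k * fact k) * expectation (\<lambda>\<omega>. (Z \<omega>)\<^sup>2) ^ k / a ^ (2 * k)"
proof -
  have [measurable]: "Z \<in> borel_measurable M" using g unfolding gaussian_rv_def by blast
  have "a ^ (2 * k) \<le> Z \<omega> ^ (2 * k)" if "a < \<bar>Z \<omega>\<bar>" for \<omega>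
    using power_mono[of a "\<bar>Z \<omega>\<bar>" "2 * k"] that a by (simp add: power_even_abs)
  then have "prob {\<omega> \<in> space M. a < \<bar>Z \<omega>\<bar>} \<le> prob {\<omega> \<in> space M. a ^ (2 * k) \<le> Z \<omega> ^ (2 * k)}"
    by (intro finite_measure_mono) auto
  also have "\<dots> \<le> expectation (\<lambda>\<omega>. Z \<omega> ^ (2 * k)) / a ^ (2 * k)"
    using centered_gaussian_moment(1)[OF g mean, of k] a
    by (intro integral_Markov_inequality_measure[where A = "space M"]) auto
  finally show ?thesis unfolding centered_gaussian_moment(2)[OF g mean] .
qed

lemma (in prob_space) centered_gaussian_small_ball:
  assumes g: "gaussian_rv M Z" and mean: "expectation Z = 0"
    and v: "0 < v" "v \<le> expectation (\<lambda>\<omega>. (Z \<omega>)\<^sup>2)" and r: "0 \<le> r"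
  shows "prob {\<omega> \<in> space M. \<bar>Z \<omega> - c\<bar> \<le> r} \<le> 1 / sqrt v * r"
  using g mean
proof (cases rule: centered_gaussian_cases)
  case zero
  have "Z \<in> borel_measurable M" using g unfolding gaussian_rv_def by blast
  then have "expectation (\<lambda>\<omega>. (Z \<omega>)\<^sup>2) = expectation (\<lambda>_. 0)"
    using zero by (intro integral_cong_AE) auto
  then show ?thesis using v by simp
next
  case (normal \<sigma>)
  have "v \<le> \<sigma>\<^sup>2"
    using normal_distributed_variance[OF normal] normal_distributed_expectation[OF normal] v by simp
  then have "sqrt v \<le> \<sigma>" using normal(1) real_le_lsqrt by auto
  \<comment> \<open>The density is at most 1/(2\<sigma>), so an interval of length 2r has
    probability at most r/\<sigma>, whatever its centre.\<close>
  have "4 \<le> 2 * pi" using pi_ge_two by simp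
  then have "2 * \<sigma> \<le> sqrt (2 * pi * \<sigma>\<^sup>2)"
    using normal(1) by (intro real_le_rsqrt) (simp add: power_mult_distrib)
  then have dens: "normal_density 0 \<sigma> z \<le> 1 / (2 * \<sigma>)" for z
  proof -
    have "normal_density 0 \<sigma> z \<le> 1 / sqrt (2 * pi * \<sigma>\<^sup>2) * 1"
      unfolding normal_density_def by (intro mult_left_mono) auto
    also have "\<dots> \<le> 1 / (2 * \<sigma>)" using \<open>2 * \<sigma> \<le> _\<close> normal(1) by (auto intro!: divide_left_mono mult_pos_pos)
    finally show ?thesis .
  qed
  have "emeasure M (Z -` {c - r..c + r} \<inter> space M) =
      (\<integral>\<^sup>+z. ennreal (normal_density 0 \<sigma> z) * indicator {c - r..c + r} z \<partial>lborel)"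
    by (rule distributed_emeasure[OF normal(2)]) simp
  also have "\<dots> \<le> (\<integral>\<^sup>+z. ennreal (1 / (2 * \<sigma>)) * indicator {c - r..c + r} z \<partial>lborel)"
    using dens by (intro nn_integral_mono mult_right_mono ennreal_leI) auto
  also have "\<dots> = ennreal (1 / (2 * \<sigma>)) * ennreal (2 * r)"
    using r by (simp add: nn_integral_cmult_indicator)
  also have "\<dots> = ennreal (r / \<sigma>)"
    using r normal(1) by (simp flip: ennreal_mult)
  also have "Z -` {c - r..c + r} \<inter> space M = {\<omega> \<in> space M. \<bar>Z \<omega> - c\<bar> \<le> r}" by (auto simp: abs_le_iff)
  finally have "prob {\<omega> \<in> space M. \<bar>Z \<omega> - c\<bar> \<le> r} \<le> r / \<sigma>"
    using r normal(1) by (simp add: emeasure_eq_measure)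
  also have "\<dots> \<le> r / sqrt v" using r v normal(1) \<open>sqrt v \<le> \<sigma>\<close> by (intro divide_left_mono) auto
  finally show ?thesis by simp
qed

lemma gaussian_process_rv:
  assumes "gaussian_process M T Y" "t \<in> T"
  shows "gaussian_rv M (Y t)"
proof -
  have "gaussian_rv M (\<lambda>\<omega>. \<Sum>u\<in>{t}. 1 * Y u \<omega>)"
    using assms unfolding gaussian_process_def
    by (elim conjE allE[of _ "{t}"] allE[of _ "\<lambda>_. 1"]) auto
  then show ?thesis by simp
qed

lemma gaussian_process_diff_rv:
  assumes "gaussian_process M T Y" "s \<in> T" "t \<in> T" "s \<noteq> t"
  shows "gaussian_rv M (\<lambda>\<omega>. Y t \<omega> - Y s \<omega>)"
proof -
  have "gaussian_rv M (\<lambda>\<omega>. \<Sum>u\<in>{s, t}. (if u = t then 1 else - 1) * Y u \<omega>)"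
    using assms unfolding gaussian_process_def
    by (elim conjE allE[of _ "{s, t}"] allE[of _ "\<lambda>u. if u = t then 1 else - 1"]) auto
  then show ?thesis using assms(4) by simp
qed

text \<open>Pointwise positivity becomes uniform by compactness: a sequence of times with second
  moments tending to 0 would accumulate at a time where the second moment is 0.\<close>

lemma (in prob_space) second_moment_bounded_below:
  fixes x :: "real \<Rightarrow> 'a \<Rightarrow> real"
  assumes sq: "\<And>t. t \<in> {a..b} \<Longrightarrow> integrable M (\<lambda>\<omega>. (x t \<omega>)\<^sup>2)"
    and meas: "\<And>t. t \<in> {a..b} \<Longrightarrow> x t \<in> borel_measurable M"
    and pos: "\<And>t. t \<in> {a..b} \<Longrightarrow> expectation (\<lambda>\<omega>. (x t \<omega>)\<^sup>2) > 0"
    and inc: "\<And>s t. s \<in> {a..b} \<Longrightarrow> t \<in> {a..b} \<Longrightarrow>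
      expectation (\<lambda>\<omega>. (x t \<omega> - x s \<omega>)\<^sup>2) \<le> C * \<bar>t - s\<bar> powr p"
    and p: "0 < p"
  shows "\<exists>v>0. \<forall>t\<in>{a..b}. v \<le> expectation (\<lambda>\<omega>. (x t \<omega>)\<^sup>2)"
proof (rule ccontr)
  let ?V = "\<lambda>t. expectation (\<lambda>\<omega>. (x t \<omega>)\<^sup>2)"
  assume "\<not> ?thesis"
  then have "\<forall>n. \<exists>t\<in>{a..b}. ?V t < 1 / real (Suc n)" by (metis not_le of_nat_0_less_iff zero_less_Suc zero_less_divide_1_iff)
  then obtain \<tau> where \<tau>: "\<And>n. \<tau> n \<in> {a..b}" "\<And>n. ?V (\<tau> n) < 1 / real (Suc n)" by metis
  obtain l \<phi> where l: "l \<in> {a..b}" and \<phi>: "strict_mono \<phi>" and lim: "(\<tau> \<circ> \<phi>) \<longlonglongrightarrow> l"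
    using compact_Icc[of a b] \<tau>(1) unfolding compact_def by metis
  \<comment> \<open>Squaring x(l) = x(t) - (x(t) - x(l)); this one-sided estimate replaces
    continuity of the second moment.\<close>
  have bound: "?V l \<le> 2 * ?V t + 2 * (C * \<bar>t - l\<bar> powr p)" if t: "t \<in> {a..b}" for t
  proof -
    note [measurable] = meas[OF t] meas[OF l]
    have ineq: "(u - w)\<^sup>2 \<le> 2 * u\<^sup>2 + 2 * w\<^sup>2" for u w :: real
      using zero_le_power2[of "u + w"] by (simp add: power2_eq_square algebra_simps)
    have int: "integrable M (\<lambda>\<omega>. (x t \<omega> - x l \<omega>)\<^sup>2)"
      by (rule Bochner_Integration.integrable_bound[of _ "\<lambda>\<omega>. 2 * (x t \<omega>)\<^sup>2 + 2 * (x l \<omega>)\<^sup>2"])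
         (use sq[OF t] sq[OF l] ineq in auto)
    have "?V l \<le> expectation (\<lambda>\<omega>. 2 * (x t \<omega>)\<^sup>2 + 2 * (x t \<omega> - x l \<omega>)\<^sup>2)"
    proof (intro integral_mono)
      show "(x l \<omega>)\<^sup>2 \<le> 2 * (x t \<omega>)\<^sup>2 + 2 * (x t \<omega> - x l \<omega>)\<^sup>2" for \<omega>
        using ineq[of "x t \<omega>" "x t \<omega> - x l \<omega>"] by simp
    qed (use sq[OF l] sq[OF t] int in auto)
    also have "\<dots> = 2 * ?V t + 2 * expectation (\<lambda>\<omega>. (x t \<omega> - x l \<omega>)\<^sup>2)"
      using sq[OF t] int by simp
    finally show ?thesis using inc[OF l t] by simp
  qed
  have "(\<lambda>n. (\<tau> \<circ> \<phi>) n - l) \<longlonglongrightarrow> 0" using lim by (rule LIM_zero)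
  then have "(\<lambda>n. \<bar>(\<tau> \<circ> \<phi>) n - l\<bar> powr p) \<longlonglongrightarrow> 0"
    by (intro tendsto_zero_powrI[of _ _ _ p] tendsto_rabs_zero tendsto_const) (use p in auto)
  moreover have "(\<lambda>n. 1 / real (Suc (\<phi> n))) \<longlonglongrightarrow> 0"
    using LIMSEQ_subseq_LIMSEQ[OF LIMSEQ_Suc[OF lim_1_over_n] \<phi>] by (simp add: o_def)
  ultimately have "(\<lambda>n. 2 * (1 / real (Suc (\<phi> n))) + 2 * (C * \<bar>(\<tau> \<circ> \<phi>) n - l\<bar> powr p)) \<longlonglongrightarrow> 2 * 0 + 2 * (C * 0)"
    by (intro tendsto_intros)
  moreover have "?V l \<le> 2 * (1 / real (Suc (\<phi> n))) + 2 * (C * \<bar>(\<tau> \<circ> \<phi>) n - l\<bar> powr p)" for n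
    using bound[OF \<tau>(1)[of "\<phi> n"]] \<tau>(2)[of "\<phi> n"] by simp
  ultimately have "?V l \<le> 2 * 0 + 2 * (C * 0)"
    by (intro LIMSEQ_le_const) auto
  then show False using pos[OF l] by simp
qed

subsection \<open>Independent copies of a Gaussian process\<close>

lemma measurable_path_eval:
  "0 \<le> t \<Longrightarrow> (\<lambda>f. f t) \<in> borel_measurable path_space"
  by (rule measurable_component_singleton) simp

lemma independent_copies_measurable:
  assumes "prob_space M" "independent_copies M I Y N x" "i \<in> I"
  shows "path (Y i) \<in> measurable M path_space"
    and "0 \<le> t \<Longrightarrow> Y i t \<in> borel_measurable M"
proof -
  interpret prob_space M by fact
  show m: "path (Y i) \<in> measurable M path_space"
    using assms(2,3) unfolding independent_copies_def indep_vars_def by auto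
  show "Y i t \<in> borel_measurable M" if "0 \<le> t"
    using measurable_compose[OF m measurable_path_eval[OF that]] that by (simp add: path_def)
qed

text \<open>Equality of laws on path space transfers every event of the path at once; below it
  serves one-time small balls and two-time increments.\<close>

lemma independent_copies_prob_eq:
  assumes M: "prob_space M" and ic: "independent_copies M I Y N x" and i: "i \<in> I"
    and x: "\<And>t. 0 \<le> t \<Longrightarrow> x t \<in> borel_measurable N"
    and P: "{f \<in> space path_space. P f} \<in> sets path_space"
  shows "measure M {\<omega> \<in> space M. P (path (Y i) \<omega>)} = measure N {\<omega> \<in> space N. P (path x \<omega>)}"
proof -
  have pY: "path (Y i) \<in> measurable M path_space"
    using independent_copies_measurable(1)[OF M ic i] .
  have px: "path x \<in> measurable N path_space"
    unfolding path_def using x by (intro measurable_restrict) auto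
  let ?A = "{f \<in> space path_space. P f}"
  have "measure M {\<omega> \<in> space M. P (path (Y i) \<omega>)} = measure M (path (Y i) -` ?A \<inter> space M)"
    using measurable_space[OF pY] by (intro arg_cong[of _ _ "measure M"]) auto
  also have "\<dots> = measure (distr M path_space (path (Y i))) ?A"
    using pY P by (simp add: measure_distr)
  also have "distr M path_space (path (Y i)) = distr N path_space (path x)"
    using ic i unfolding independent_copies_def by blast
  also have "measure (distr N path_space (path x)) ?A = measure N (path x -` ?A \<inter> space N)"
    using px P by (simp add: measure_distr)
  also have "\<dots> = measure N {\<omega> \<in> space N. P (path x \<omega>)}"
    using measurable_space[OF px] by (intro arg_cong[of _ _ "measure N"]) auto
  finally show ?thesis .
qed

lemma independent_copies_box_prob:
  assumes M: "prob_space M" and ic: "independent_copies M I Y N x" and I: "finite I" "I \<noteq> {}" and t: "0 \<le> t"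
  shows "measure M {\<omega> \<in> space M. \<forall>i\<in>I. \<bar>Y i t \<omega> - g i\<bar> \<le> r} =
    (\<Prod>i\<in>I. measure M {\<omega> \<in> space M. \<bar>Y i t \<omega> - g i\<bar> \<le> r})"
proof -
  interpret prob_space M by fact
  define A where "A i = {f \<in> space path_space. \<bar>f t - g i\<bar> \<le> r}" for i
  have A: "A i \<in> sets path_space" for i
  proof -
    note [measurable] = measurable_path_eval[OF t]
    show ?thesis unfolding A_def by measurable
  qed
  have pre: "path (Y i) -` A i \<inter> space M = {\<omega> \<in> space M. \<bar>Y i t \<omega> - g i\<bar> \<le> r}" if "i \<in> I" for i
    using measurable_space[OF independent_copies_measurable(1)[OF M ic that]] t
    by (auto simp: A_def path_def)
  have "prob (\<Inter>i\<in>I. path (Y i) -` A i \<inter> space M) = (\<Prod>i\<in>I. prob (path (Y i) -` A i \<inter> space M))"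
    using ic I A unfolding independent_copies_def by (intro indep_varsD_finite) auto
  also have "(\<Inter>i\<in>I. path (Y i) -` A i \<inter> space M) = {\<omega> \<in> space M. \<forall>i\<in>I. \<bar>Y i t \<omega> - g i\<bar> \<le> r}"
    using I pre by auto
  finally show ?thesis using pre by simp
qed

text \<open>An affine change of time carries [a, b] to [0, 1], and the map y \<mapsto> m + c y is
  undone on the side of D. Since a > 0, the second moments are bounded below on [a, b], which makes
  the small-ball constant uniform.\<close>

lemma gaussian_copies_hitting_prob_zero:
  fixes x :: "real \<Rightarrow> 'b \<Rightarrow> real" and Y :: "'i \<Rightarrow> real \<Rightarrow> 'a \<Rightarrow> real" and D :: "('i \<Rightarrow> real) set"
  assumes \<gamma>: "1 / 2 < \<gamma>" and N: "prob_space N" and gp: "gaussian_process N {0..} x"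
    and mean: "\<And>t. t \<ge> 0 \<Longrightarrow> prob_space.expectation N (x t) = 0"
    and var: "\<And>t. t > 0 \<Longrightarrow> prob_space.variance N (x t) > 0"
    and inc: "\<And>T. T > 0 \<Longrightarrow> \<exists>C. \<forall>s\<in>{0..T}. \<forall>t\<in>{0..T}.
           prob_space.expectation N (\<lambda>\<omega>. \<bar>x t \<omega> - x s \<omega>\<bar>\<^sup>2) \<le> C * \<bar>t - s\<bar> powr (2 * \<gamma>)"
    and M: "prob_space M" and ic: "independent_copies M I Y N x"
    and cont: "\<And>i \<omega>. i \<in> I \<Longrightarrow> \<omega> \<in> space M \<Longrightarrow> continuous_on {0..} (\<lambda>t. Y i t \<omega>)"
    and I: "finite I" "2 \<le> card I" and ab: "0 < a" "a < b"
    and c: "\<And>i. i \<in> I \<Longrightarrow> 1 \<le> c i"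
    and cover: "\<And>r. 0 < r \<Longrightarrow> r \<le> 1 \<Longrightarrow> \<exists>G. finite G \<and> real (card G) * r ^ (card I - 2) \<le> B \<and>
       (\<forall>z\<in>D. \<exists>g\<in>G. \<forall>i\<in>I. \<bar>z i - g i\<bar> \<le> r)"
    and S: "S \<in> sets M" "\<And>\<omega>. \<omega> \<in> S \<Longrightarrow> \<exists>t\<in>{a..b}. \<exists>z\<in>D. \<forall>i\<in>I. m i + c i * Y i t \<omega> = z i"
  shows "measure M S = 0"
proof -
  interpret N: prob_space N by fact
  interpret M: prob_space M by fact
  have xm: "x t \<in> borel_measurable N" if "0 \<le> t" for t
    using gp that unfolding gaussian_process_def by simp
  have g: "gaussian_rv N (x t)" if "0 \<le> t" for t using gaussian_process_rv[OF gp] that by simp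
  have gd: "gaussian_rv N (\<lambda>\<omega>. x t \<omega> - x s \<omega>)" if "0 \<le> s" "0 \<le> t" "s \<noteq> t" for s t
    using gaussian_process_diff_rv[OF gp] that by simp
  have md: "N.expectation (\<lambda>\<omega>. x t \<omega> - x s \<omega>) = 0" if "0 \<le> s" "0 \<le> t" for s t
    using that N.centered_gaussian_integrable[OF g mean] mean by simp
  obtain C where "\<forall>s\<in>{0..b}. \<forall>t\<in>{0..b}.
      N.expectation (\<lambda>\<omega>. (x t \<omega> - x s \<omega>)\<^sup>2) \<le> C * \<bar>t - s\<bar> powr (2 * \<gamma>)"
    using inc[of b, unfolded power2_abs] ab by (meson order.strict_trans)
  then have C: "N.expectation (\<lambda>\<omega>. (x t \<omega> - x s \<omega>)\<^sup>2) \<le> C * \<bar>t - s\<bar> powr (2 * \<gamma>)"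
    if "s \<in> {0..b}" "t \<in> {0..b}" for s t using that by blast
  have "\<exists>v>0. \<forall>t\<in>{a..b}. v \<le> N.expectation (\<lambda>\<omega>. (x t \<omega>)\<^sup>2)"
  proof (rule N.second_moment_bounded_below)
    show "N.expectation (\<lambda>\<omega>. (x t \<omega> - x s \<omega>)\<^sup>2) \<le> C * \<bar>t - s\<bar> powr (2 * \<gamma>)"
      if "s \<in> {a..b}" "t \<in> {a..b}" for s t using C that ab by auto
    show "0 < N.expectation (\<lambda>\<omega>. (x t \<omega>)\<^sup>2)" if "t \<in> {a..b}" for t
      using var[of t] mean[of t] that ab by auto
    show "integrable N (\<lambda>\<omega>. (x t \<omega>)\<^sup>2)" if "t \<in> {a..b}" for t
      using N.centered_gaussian_moment(1)[OF g mean, of t 1] that ab by simp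
  qed (use xm ab \<gamma> in auto)
  then obtain v where v: "0 < v" "\<And>t. t \<in> {a..b} \<Longrightarrow> v \<le> N.expectation (\<lambda>\<omega>. (x t \<omega>)\<^sup>2)" by blast

  define h where "h = b - a"
  have h: "0 < h" using ab unfolding h_def by simp
  define \<tau> where "\<tau> u = a + h * u" for u
  have \<tau>: "\<tau> u \<in> {a..b}" "0 \<le> \<tau> u" if "u \<in> {0..1}" for u
  proof -
    have "h * u \<le> h" "0 \<le> h * u" using that h by (auto simp: mult_left_le)
    moreover have "a + h = b" unfolding h_def by simp
    ultimately have "a \<le> \<tau> u" "\<tau> u \<le> b" unfolding \<tau>_def by linarith+
    then show "\<tau> u \<in> {a..b}" "0 \<le> \<tau> u" using ab by auto
  qed
  define \<beta> where "\<beta> = (\<gamma> + 1 / 2) / 2"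
  have \<beta>: "1 / 2 < \<beta>" "\<beta> < \<gamma>" using \<gamma> unfolding \<beta>_def by auto
  \<comment> \<open>The moment of order 2k gives the tail exponent 2k(\<gamma> - \<beta>), which
    this choice pushes above 1; \<kappa> is the excess.\<close>
  obtain k :: nat where k: "1 / (\<gamma> - \<beta>) < real k" using reals_Archimedean2 by blast
  define \<kappa> where "\<kappa> = 2 * real k * (\<gamma> - \<beta>) - 1"
  have \<kappa>: "0 < \<kappa>" using k \<beta> unfolding \<kappa>_def by (simp add: field_simps)
  define A where "A = (fact (2 * k) / (2 ^ k * fact k) :: real)"
  have A: "0 \<le> A" unfolding A_def by simp
  define D' where "D' = {y. \<exists>z\<in>D. \<forall>i\<in>I. m i + c i * y i = z i}"
  show ?thesis
  proof (rule M.hitting_prob_zero[where I = I and Y = "\<lambda>i u. Y i (\<tau> u)" and D = D' and \<beta> = \<beta> and \<kappa> = \<kappa>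
        and K = "1 / sqrt v" and C = "A * (C * h powr (2 * \<gamma>)) ^ k" and B = B])
    show "(\<lambda>\<omega>. Y i (\<tau> u) \<omega>) \<in> borel_measurable M" if "i \<in> I" "u \<in> {0..1}" for i u
      using independent_copies_measurable(2)[OF M ic that(1)] \<tau>(2)[OF that(2)] by blast
    show "continuous_on {0..1} (\<lambda>u. Y i (\<tau> u) \<omega>)" if "i \<in> I" "\<omega> \<in> space M" for i \<omega>
    proof (rule continuous_on_compose2[OF cont[OF that]])
      show "continuous_on {0..1} \<tau>" unfolding \<tau>_def by (intro continuous_intros)
    qed (use \<tau>(2) in auto)
    show "M.prob {\<omega> \<in> space M. \<forall>i\<in>I. \<bar>Y i (\<tau> u) \<omega> - g i\<bar> \<le> r} =
        (\<Prod>i\<in>I. M.prob {\<omega> \<in> space M. \<bar>Y i (\<tau> u) \<omega> - g i\<bar> \<le> r})" if "u \<in> {0..1}" for u g r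
      using I \<tau>(2)[OF that] by (intro independent_copies_box_prob[OF M ic]) auto
    show "M.prob {\<omega> \<in> space M. \<bar>Y i (\<tau> u) \<omega> - e\<bar> \<le> r} \<le> 1 / sqrt v * r"
      if i: "i \<in> I" and u: "u \<in> {0..1}" and r: "0 \<le> r" for i u e r
    proof -
      note [measurable] = measurable_path_eval[OF \<tau>(2)[OF u]]
      have "M.prob {\<omega> \<in> space M. \<bar>Y i (\<tau> u) \<omega> - e\<bar> \<le> r} = N.prob {\<omega> \<in> space N. \<bar>x (\<tau> u) \<omega> - e\<bar> \<le> r}"
        using independent_copies_prob_eq[OF M ic i xm, of "\<lambda>f. \<bar>f (\<tau> u) - e\<bar> \<le> r"] \<tau>(2)[OF u]
        by (simp add: path_def)
      also have "\<dots> \<le> 1 / sqrt v * r"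
        using \<tau>[OF u] v r by (intro N.centered_gaussian_small_ball g mean) auto
      finally show ?thesis .
    qed
    show "M.prob {\<omega> \<in> space M. (t - s) powr \<beta> < \<bar>Y i (\<tau> t) \<omega> - Y i (\<tau> s) \<omega>\<bar>} \<le>
        A * (C * h powr (2 * \<gamma>)) ^ k * (t - s) powr (1 + \<kappa>)"
      if i: "i \<in> I" and st: "0 \<le> s" "s < t" "t \<le> 1" for i s t
    proof -
      have 01: "s \<in> {0..1}" "t \<in> {0..1}" using st by auto
      note [measurable] = measurable_path_eval[OF \<tau>(2)[OF 01(1)]] measurable_path_eval[OF \<tau>(2)[OF 01(2)]]
      define w where "w = t - s"
      have w: "0 < w" using st unfolding w_def by simp
      have pw: "(w powr e) ^ n = w powr (e * real n)" for e n
        using w by (simp add: powr_powr flip: powr_realpow)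
      have \<tau>st: "\<tau> t - \<tau> s = h * w" unfolding \<tau>_def w_def by (simp add: algebra_simps)
      have ne: "\<tau> s \<noteq> \<tau> t" using \<tau>st h w by auto
      define V where "V = N.expectation (\<lambda>\<omega>. (x (\<tau> t) \<omega> - x (\<tau> s) \<omega>)\<^sup>2)"
      have V: "0 \<le> V" "V \<le> C * h powr (2 * \<gamma>) * w powr (2 * \<gamma>)"
      proof -
        show "0 \<le> V" unfolding V_def by simp
        have "V \<le> C * \<bar>\<tau> t - \<tau> s\<bar> powr (2 * \<gamma>)"
          unfolding V_def using \<tau>[OF 01(1)] \<tau>[OF 01(2)] by (intro C) auto
        then show "V \<le> C * h powr (2 * \<gamma>) * w powr (2 * \<gamma>)"
          using h w unfolding \<tau>st by (simp add: powr_mult mult.assoc)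
      qed
      have "M.prob {\<omega> \<in> space M. w powr \<beta> < \<bar>Y i (\<tau> t) \<omega> - Y i (\<tau> s) \<omega>\<bar>} =
          N.prob {\<omega> \<in> space N. w powr \<beta> < \<bar>x (\<tau> t) \<omega> - x (\<tau> s) \<omega>\<bar>}"
        using independent_copies_prob_eq[OF M ic i xm, of "\<lambda>f. w powr \<beta> < \<bar>f (\<tau> t) - f (\<tau> s)\<bar>"]
          \<tau>(2)[OF 01(1)] \<tau>(2)[OF 01(2)]
        by (simp add: path_def)
      also have "\<dots> \<le> A * V ^ k / (w powr \<beta>) ^ (2 * k)"
        unfolding A_def V_def using w \<tau>(2)[OF 01(1)] \<tau>(2)[OF 01(2)] ne
        by (intro N.centered_gaussian_tail gd md) auto
      also have "\<dots> \<le> A * (C * h powr (2 * \<gamma>) * w powr (2 * \<gamma>)) ^ k / (w powr \<beta>) ^ (2 * k)"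
        using V A by (intro divide_right_mono mult_left_mono power_mono) auto
      also have "\<dots> = A * (C * h powr (2 * \<gamma>)) ^ k * (w powr (2 * \<gamma> * real k) / w powr (\<beta> * real (2 * k)))"
        unfolding power_mult_distrib[of _ "w powr (2 * \<gamma>)"] pw by simp
      also have "w powr (2 * \<gamma> * real k) / w powr (\<beta> * real (2 * k)) = w powr (1 + \<kappa>)"
        unfolding powr_diff[symmetric] \<kappa>_def by (simp add: algebra_simps)
      finally show ?thesis unfolding w_def .
    qed
    show "\<exists>G. finite G \<and> real (card G) * r ^ (card I - 2) \<le> B \<and> (\<forall>z\<in>D'. \<exists>g\<in>G. \<forall>i\<in>I. \<bar>z i - g i\<bar> \<le> r)"
      if r: "0 < r" "r \<le> 1" for r
    proof -
      obtain G where G: "finite G" "real (card G) * r ^ (card I - 2) \<le> B"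
        "\<And>z. z \<in> D \<Longrightarrow> \<exists>g\<in>G. \<forall>i\<in>I. \<bar>z i - g i\<bar> \<le> r" using cover[OF r] by blast
      \<comment> \<open>Division by c_i \<ge> 1 does not increase distances, so radius and constant
        of the cover survive.\<close>
      define f where "f g i = (g i - m i) / c i" for g i
      have "real (card (f ` G)) * r ^ (card I - 2) \<le> real (card G) * r ^ (card I - 2)"
        using r card_image_le[OF G(1)] by (intro mult_right_mono) auto
      moreover have "\<exists>g\<in>f ` G. \<forall>i\<in>I. \<bar>y i - g i\<bar> \<le> r" if y: "y \<in> D'" for y
      proof -
        obtain z where z: "z \<in> D" "\<And>i. i \<in> I \<Longrightarrow> m i + c i * y i = z i" using y unfolding D'_def by blast
        obtain g where g: "g \<in> G" "\<And>i. i \<in> I \<Longrightarrow> \<bar>z i - g i\<bar> \<le> r" using G(3)[OF z(1)] by blast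
        have "\<bar>y i - f g i\<bar> \<le> r" if i: "i \<in> I" for i
        proof -
          have "y i - f g i = (z i - g i) / c i"
            using c[OF i] unfolding f_def z(2)[OF i, symmetric] by (simp add: field_simps)
          then have "\<bar>y i - f g i\<bar> = \<bar>z i - g i\<bar> / c i" using c[OF i] by simp
          also have "\<dots> \<le> \<bar>z i - g i\<bar> / 1" using c[OF i] by (intro divide_left_mono) auto
          finally show ?thesis using g(2)[OF i] by simp
        qed
        then show ?thesis using g(1) by blast
      qed
      ultimately show ?thesis using G(1,2) by (intro exI[of _ "f ` G"]) auto
    qed
    show "\<exists>u\<in>{0..1}. \<exists>z\<in>D'. \<forall>i\<in>I. Y i (\<tau> u) \<omega> = z i" if \<omega>: "\<omega> \<in> S" for \<omega>
    proof -
      obtain t z where t: "t \<in> {a..b}" and z: "z \<in> D" "\<And>i. i \<in> I \<Longrightarrow> m i + c i * Y i t \<omega> = z i"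
        using S(2)[OF \<omega>] by blast
      define u where "u = (t - a) / h"
      have "u \<in> {0..1}" using t h unfolding u_def h_def by (auto simp: field_simps)
      moreover have "\<tau> u = t" using h unfolding \<tau>_def u_def by simp
      moreover have "(\<lambda>i. Y i t \<omega>) \<in> D'" using z unfolding D'_def by blast
      ultimately show ?thesis by (intro bexI[of _ u] bexI[of _ "\<lambda>i. Y i t \<omega>"]) auto
    qed
  qed (use I \<beta> \<kappa> S(1) in auto)
qed

section \<open>Application to the eigenvalues of the matrix process\<close>

theorem theorem4p1:
  fixes \<gamma> :: real
    and N :: "'b measure" and x :: "real \<Rightarrow> 'b \<Rightarrow> real"
    and M :: "'a measure" and xs :: "nat \<times> nat \<Rightarrow> real \<Rightarrow> 'a \<Rightarrow> real"
    and d :: nat and X0 :: "real mat" and X :: "real \<Rightarrow> 'a \<Rightarrow> real mat"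
  assumes "1 / 2 < \<gamma>" and "\<gamma> < 1"
    and "prob_space N"
    and "gaussian_process N {0..} x"
    and "\<And>t. t \<ge> 0 \<Longrightarrow> prob_space.expectation N (x t) = 0"
    and "AE \<omega> in N. x 0 \<omega> = 0"
    and "\<And>t. t > 0 \<Longrightarrow> prob_space.variance N (x t) > 0"
    and "\<And>T. T > 0 \<Longrightarrow> \<exists>C. \<forall>s\<in>{0..T}. \<forall>t\<in>{0..T}.
           prob_space.expectation N (\<lambda>\<omega>. \<bar>x t \<omega> - x s \<omega>\<bar>\<^sup>2) \<le> C * \<bar>t - s\<bar> powr (2 * \<gamma>)"
    and "prob_space M"
    and "independent_copies M {(i, j). i \<le> j \<and> j < d} xs N x"
    and "\<And>i j \<omega>. i \<le> j \<Longrightarrow> j < d \<Longrightarrow> \<omega> \<in> space M \<Longrightarrow>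
           continuous_on {0..} (\<lambda>t. xs (i, j) t \<omega>)"
    and "X0 \<in> carrier_mat d d" and "transpose_mat X0 = X0"
    and "\<And>t \<omega>. X t \<omega> = X0 + sym_noise d xs t \<omega>"
  shows "prob_space.prob M {\<omega> \<in> space M. \<forall>t>0. \<forall>i j. i < j \<and> j < d \<longrightarrow>
           eigval (X t \<omega>) i > eigval (X t \<omega>) j} = 1"
proof -
  interpret M: prob_space M by fact
  define I where "I = {(i, j). i \<le> j \<and> j < d}"
  define c where "c = (\<lambda>(i::nat, j::nat). if i = j then sqrt 2 else 1)"
  have ic: "independent_copies M I xs N x" using assms(10) unfolding I_def .
  have finI: "finite I" unfolding I_def by (rule finite_upper_index)
  have xm: "xs k t \<in> borel_measurable M" if "k \<in> I" "0 \<le> t" for k t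
    using independent_copies_measurable(2)[OF assms(9) ic that] .
  have xc: "continuous_on {0..} (\<lambda>t. xs k t \<omega>)" if "k \<in> I" "\<omega> \<in> space M" for k \<omega>
    using assms(11) that unfolding I_def by auto
  have X: "X t \<omega> \<in> carrier_mat d d" "transpose_mat (X t \<omega>) = X t \<omega>" for t \<omega>
  proof -
    have sn: "sym_noise d xs t \<omega> \<in> carrier_mat d d" unfolding sym_noise_def by simp
    then show "X t \<omega> \<in> carrier_mat d d" using assms(12) unfolding assms(14) by simp
    have "transpose_mat (sym_noise d xs t \<omega>) = sym_noise d xs t \<omega>"
      by (rule eq_matI) (auto simp: sym_noise_def)
    then show "transpose_mat (X t \<omega>) = X t \<omega>"
      using assms(12,13) sn unfolding assms(14) by (simp add: transpose_add)
  qed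
  have entry: "X t \<omega> $$ k = X0 $$ k + c k * xs k t \<omega>" if "k \<in> I" for k t \<omega>
    using that assms(12) unfolding assms(14) I_def c_def sym_noise_def by auto
  \<comment> \<open>The upper triangle, padded by 0 as in \<open>degen_set\<close>, so that both
    live in the same function space with its product topology.\<close>
  define Z where "Z t \<omega> = (\<lambda>(i, j). if i \<le> j \<and> j < d then X t \<omega> $$ (i, j) else 0)" for t \<omega>
  have Z: "Z t \<omega> k = (if k \<in> I then X0 $$ k + c k * xs k t \<omega> else 0)" for t \<omega> k
    using entry[of k] unfolding Z_def I_def by (auto split: prod.splits)
  \<comment> \<open>The shift by 2 makes each interval nondegenerate, including l = 0; together they
    exhaust the positive times.\<close>
  define H where "H p q R l =
    {\<omega> \<in> space M. \<exists>t\<in>{1 / (real l + 2)..real l + 2}. Z t \<omega> \<in> degen_set d p q (real R)}"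
    for p q R l :: nat
  have H: "H p q R l \<in> sets M" for p q R l
    unfolding H_def
  proof (rule hitting_event_measurable)
    show "Z t \<in> borel_measurable M" if t: "t \<in> {1 / (real l + 2)..real l + 2}" for t
    proof (rule measurable_coordinatewise_then_product)
      have "0 \<le> 1 / (real l + 2)" by simp
      then have t0: "0 \<le> t" using t by (meson atLeastAtMost_iff order_trans)
      show "(\<lambda>\<omega>. Z t \<omega> k) \<in> borel_measurable M" for k
        unfolding Z using xm[of k t] t0 by (cases "k \<in> I") auto
    qed
    show "continuous_on {1 / (real l + 2)..real l + 2} (\<lambda>t. Z t \<omega>)" if "\<omega> \<in> space M" for \<omega>
    proof (rule continuous_on_coordinatewise_then_product)
      have "{u..w} \<subseteq> {0..}" if "0 \<le> u" for u w :: real using that by auto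
      then have "{1 / (real l + 2)..real l + 2} \<subseteq> {0..}" by simp
      then show "continuous_on {1 / (real l + 2)..real l + 2} (\<lambda>t. Z t \<omega> k)" for k
        unfolding Z using continuous_on_subset[OF xc[of k \<omega>]] that
        by (cases "k \<in> I") (auto intro!: continuous_intros)
    qed
  qed (simp_all add: closed_degen_set)
  have H0: "M.prob (H p q R l) = 0" if pq: "p < q" "q < d" for p q R l
  proof -
    obtain B where B: "\<And>r. 0 < r \<Longrightarrow> r \<le> 1 \<Longrightarrow> \<exists>G. finite G \<and> real (card G) * r ^ (card I - 2) \<le> B \<and>
        (\<forall>z\<in>degen_set d p q (real R). \<exists>g\<in>G. \<forall>k\<in>I. \<bar>z k - g k\<bar> \<le> r)"
      using degen_set_cover[OF pq, of "real R", folded I_def] of_nat_0_le_iff[of R] by blast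
    \<comment> \<open>Two diagonal places show that the truncated difference
      \<open>card I - 2\<close> is a genuine one.\<close>
    have "{(p, p), (q, q)} \<subseteq> I" using pq unfolding I_def by auto
    from card_mono[OF finI this] have cI: "2 \<le> card I" using pq by simp
    have "1 / (real l + 2) \<le> 1" by simp
    then have ab: "0 < 1 / (real l + 2)" "1 / (real l + 2) < real l + 2"
      by (simp, linarith)
    show ?thesis
    proof (rule gaussian_copies_hitting_prob_zero[OF assms(1,3,4,5,7,8) assms(9) ic xc finI cI ab,
          where c = c and m = "\<lambda>k. X0 $$ k" and D = "degen_set d p q (real R)" and B = B and S = "H p q R l"])
      show "1 \<le> c k" for k unfolding c_def by (auto split: prod.splits)
      show "\<exists>t\<in>{1 / (real l + 2)..real l + 2}. \<exists>z\<in>degen_set d p q (real R). \<forall>k\<in>I. X0 $$ k + c k * xs k t \<omega> = z k"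
        if \<omega>: "\<omega> \<in> H p q R l" for \<omega>
      proof -
        obtain t where "t \<in> {1 / (real l + 2)..real l + 2}" "Z t \<omega> \<in> degen_set d p q (real R)"
          using \<omega> unfolding H_def by blast
        then show ?thesis by (intro bexI[of _ t] bexI[of _ "Z t \<omega>"]) (auto simp: Z)
      qed
      show "H p q R l \<in> sets M" by (fact H)
    qed (use B in blast)+
  qed
  define Bad where "Bad = (\<Union>(p, q)\<in>{(p, q). p < q \<and> q < d}. \<Union>R. \<Union>l. H p q R l)"
  have bad: "Bad \<in> null_sets M"
  proof -
    have "H p q R l \<in> null_sets M" if "p < q" "q < d" for p q R l
      using H H0[OF that] by (simp add: null_sets_def M.emeasure_eq_measure)
    then have "(\<Union>R. \<Union>l. H p q R l) \<in> null_sets M" if "p < q" "q < d" for p q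
      using that by (intro null_sets_UN)
    then show ?thesis unfolding Bad_def by (intro null_sets_UN' countableI_type) auto
  qed
  \<comment> \<open>An equivalence rather than an implication: M need not be complete, so
    measurability of the event itself comes from identifying it with the complement of the
    measurable null set \<open>Bad\<close>. For d \<le> 1 no pair p < q < d exists and
    \<open>Bad\<close> is empty.\<close>
  have "(\<forall>t>0. \<forall>i j. i < j \<and> j < d \<longrightarrow> eigval (X t \<omega>) i > eigval (X t \<omega>) j) \<longleftrightarrow> \<omega> \<notin> Bad"
    if \<omega>: "\<omega> \<in> space M" for \<omega>
  proof -
    have spec: "(\<forall>i j. i < j \<and> j < d \<longrightarrow> eigval (X t \<omega>) i > eigval (X t \<omega>) j) \<longleftrightarrow>
      \<not> (\<exists>p q. p < q \<and> q < d \<and> (\<exists>R::nat. Z t \<omega> \<in> degen_set d p q (real R)))" for t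
    proof -
      have "(\<exists>\<theta>. \<forall>i j. i \<le> j \<and> j < d \<longrightarrow> X t \<omega> $$ (i, j) = degen_entry d p q \<theta> i j) \<longleftrightarrow>
          (\<exists>R::nat. Z t \<omega> \<in> degen_set d p q (real R))" if "p < q" "q < d" for p q
        unfolding Z_def by (rule degenerate_iff_degen_set[OF that])
      then show ?thesis unfolding simple_spectrum_iff[OF X] by (simp cong: conj_cong)
    qed
    have "(\<forall>t>0. \<forall>i j. i < j \<and> j < d \<longrightarrow> eigval (X t \<omega>) i > eigval (X t \<omega>) j) \<longleftrightarrow>
      \<not> (\<exists>t>0. \<exists>p q. p < q \<and> q < d \<and> (\<exists>R::nat. Z t \<omega> \<in> degen_set d p q (real R)))"
      unfolding spec by simp
    also have "(\<exists>t>0. \<exists>p q. p < q \<and> q < d \<and> (\<exists>R::nat. Z t \<omega> \<in> degen_set d p q (real R))) \<longleftrightarrow> \<omega> \<in> Bad"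
    proof
      assume "\<exists>t>0. \<exists>p q. p < q \<and> q < d \<and> (\<exists>R::nat. Z t \<omega> \<in> degen_set d p q (real R))"
      then obtain t p q and R :: nat where t: "0 < t" and pq: "p < q" "q < d"
        and R: "Z t \<omega> \<in> degen_set d p q (real R)" by blast
      obtain l :: nat where l: "max t (1 / t) \<le> real l" using real_arch_simple by blast
      have "1 / (real l + 2) \<le> t"
      proof -
        have "1 \<le> real l * t" using l t by (simp add: divide_le_eq)
        then have "1 \<le> t * (real l + 2)" using t by (simp add: algebra_simps)
        then show ?thesis by (simp add: divide_le_eq)
      qed
      then have "t \<in> {1 / (real l + 2)..real l + 2}" using l by simp
      then have "\<omega> \<in> H p q R l" using \<omega> R unfolding H_def by blast
      then show "\<omega> \<in> Bad" using pq unfolding Bad_def by blast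
    next
      assume "\<omega> \<in> Bad"
      then obtain p q R l where pq: "p < q" "q < d" and "\<omega> \<in> H p q R l" unfolding Bad_def by blast
      then obtain t where t: "t \<in> {1 / (real l + 2)..real l + 2}" "Z t \<omega> \<in> degen_set d p q (real R)"
        unfolding H_def by blast
      have "0 < 1 / (real l + 2)" by simp
      then have "0 < t" using t(1) by (meson atLeastAtMost_iff less_le_trans)
      then show "\<exists>t>0. \<exists>p q. p < q \<and> q < d \<and> (\<exists>R::nat. Z t \<omega> \<in> degen_set d p q (real R))"
        using t(2) pq by blast
    qed
    finally show ?thesis .
  qed
  then have eq: "{\<omega> \<in> space M. \<forall>t>0. \<forall>i j. i < j \<and> j < d \<longrightarrow> eigval (X t \<omega>) i > eigval (X t \<omega>) j} = space M - Bad"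
    by blast
  have "M.prob (space M - Bad) = 1"
    using M.prob_compl[OF null_setsD2[OF bad]] measure_eq_0_null_sets[OF bad] by simp
  then show ?thesis unfolding eq .
qed

end
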